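(* For every convex hexagon in the plane (with exactly six vertices), its vertices can be labeled $A,B,C,D,E,F$ in cyclic order along the boundary so that there exist points $G,H$ in the plane for which $BCDGH$ is a convex pentagon (with vertices $B,C,D,G,H$ in this cyclic order) that contains the hexagon $ABCDEF$ and satisfies $$|BCDGH|\le \frac{7}{6}\cdot|ABCDEF|.$$
   Context: Polygons are regarded as compact convex regions of the plane $\mathbb{R}^2$ with nonempty interior, and $|\cdot|$ denotes area. "Labeled in cyclic order" means that the vertices are listed consecutively along the boundary, starting at any vertex and in either direction. *)

theory Defs
  imports "HOL-Analysis.Analysis"
begin

definition convex_polygon :: "(real^2) set \<Rightarrow> bool" where
  "convex_polygon P \<longleftrightarrow> polytope P \<and> interior P \<noteq> {}"

definition vertices :: "(real^2) set \<Rightarrow> (real^2) set" where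
  "vertices P = {v. v extreme_point_of P}"

(* The list contains every vertex exactly once, and cyclically consecutive entries are the
   endpoints of an edge of P. The starting vertex and the orientation are left free. *)
definition cyclic_vertices :: "(real^2) set \<Rightarrow> (real^2) list \<Rightarrow> bool" where
  "cyclic_vertices P vs \<longleftrightarrow>
     distinct vs \<and> set vs = vertices P \<and>
     (\<forall>i<length vs. closed_segment (vs ! i) (vs ! (Suc i mod length vs)) edge_of P)"

abbreviation area :: "(real^2) set \<Rightarrow> real" where
  "area P \<equiv> measure lebesgue P"

end

theory Submission
  imports Defs
begin

text \<open>
  It is enough to look at pentagons of a very special kind. Take an edge \<open>EF\<close> of the hexagon
  \<open>ABCDEF\<close> such that the lines \<open>DE\<close> and \<open>AF\<close>, prolonged beyond \<open>E\<close> and \<open>F\<close>, meet in a point \<open>G\<close>.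
  Then \<open>ABCDG\<close> is a convex pentagon that arises from the hexagon by adding the triangle \<open>EGF\<close>,
  called here the \<^emph>\<open>cap\<close> of the edge \<open>EF\<close>, and its vertices, listed from \<open>B\<close>, are
  \<open>B, C, D, G, A\<close>. So the claim is that some cap has at most one sixth of the area of the hexagon
  (\<open>ex_small_cap\<close>), with equality in the regular case. Equivalently, if all existing caps have
  doubled area at least \<open>\<mu>\<close>, then the doubled area of the hexagon is at least \<open>6 \<mu>\<close>
  (\<open>area2_ge_of_large_caps\<close>).

  An edge has no cap if its two exterior angles add up to at least \<open>\<pi>\<close>. As all exterior angles add up
  to \<open>2 \<pi>\<close>, opposite edges cannot both be of this kind. Hence either every second edge has a cap,
  or two adjacent edges have none.

  In the first case the three remaining edges span a triangle, and the hexagon is this triangle with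
  three corners cut off. In units of the prescribed cap area, let \<open>L\<^sup>2\<close> be the area of the triangle
  and \<open>p\<^sup>2\<close>, \<open>q\<^sup>2\<close>, \<open>r\<^sup>2\<close> the areas of the corners, which are caps and thus at least \<open>1\<close>. One has to show
  \<open>6 + p\<^sup>2 + q\<^sup>2 + r\<^sup>2 \<le> L\<^sup>2\<close> (\<open>cut_triangle_area\<close>). With the directions of all edges fixed, moving the edge
  between two corners parallel to itself into the hexagon decreases the area of the hexagon, enlarges the cap
  of this edge, if it has one, and shrinks only the caps of its two neighbours, which are the two
  corners; this is possible until one of them has area \<open>1\<close>. Doing this twice leaves at most one corner
  of area larger than \<open>1\<close>, and then a case distinction by the shape of the corners suffices
  (\<open>one_large_corner\<close>).

  In the second case the four other edges form a convex chain inside a triangle whose area is bounded by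
  that of the triangle cut off at the common vertex of the two edges without caps. The
  inequality between arithmetic and geometric mean then compares the caps of the two inner edges
  of the chain with the area of the hexagon (\<open>area2_ge_two_capless_edges\<close>).

  What remains is planar geometry. The extreme points of a polygon, ordered by slope as seen from one of
  them, form a list whose triples are all positively oriented; this notion of a convex polygon is
  closed under rotation of the list, yields the edges of the convex hull, and gives its area as a sum
  of triangles.
\<close>

section \<open>Triangles with three corners cut off\<close>

text \<open>
  Consider one side of a triangle. Measured on an affine scale on which the side has length \<open>L\<close>, where \<open>L\<^sup>2\<close>
  is the area of the triangle, the cut at one end has area \<open>p\<^sup>2\<close> and takes the length \<open>p x\<close> from this side
  and \<open>p / x\<close> from the other one; at the other end the lengths are \<open>q y\<close> and \<open>q / y\<close>. The two cutting
  lines meet beyond the side if \<open>1 < x\<^sup>2 + y\<^sup>2\<close>, and they bound there a cap of area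
  \<open>(L - p x - q y)\<^sup>2 / (x\<^sup>2 + y\<^sup>2 - 1)\<close>. So the second condition says that a cap, if there is one, has area at
  least \<open>1\<close>.
\<close>
definition side_fits :: "real \<Rightarrow> real \<Rightarrow> real \<Rightarrow> real \<Rightarrow> real \<Rightarrow> bool" where
  "side_fits L p x q y \<longleftrightarrow> p * x + q * y \<le> L \<and> x\<^sup>2 + y\<^sup>2 - 1 \<le> (L - p * x - q * y)\<^sup>2"

lemma side_fits_commute: "side_fits L p x q y \<longleftrightarrow> side_fits L q y p x"
  by (simp add: side_fits_def add.commute diff_diff_eq)

lemma side_fits_bound:
  assumes "side_fits L p x q y" and "t\<^sup>2 \<le> x\<^sup>2 + y\<^sup>2 - 1"
  shows "p * x + q * y + t \<le> L"
proof -
  have "t\<^sup>2 \<le> (L - p * x - q * y)\<^sup>2" "0 \<le> L - p * x - q * y"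
    using assms by (auto simp: side_fits_def)
  then have "t \<le> L - p * x - q * y" by (rule power2_le_imp_le)
  then show ?thesis by simp
qed

lemma side_fits_ge_one:
  assumes "side_fits L p x q y" and "1 \<le> y"
  shows "p * x + q * y + x \<le> L"
  using assms by (intro side_fits_bound) auto

text \<open>
  For \<open>x \<ge> 1 \<ge> y\<close> the root of \<open>x\<^sup>2 + y\<^sup>2 - 1\<close> lies above its tangent plane at \<open>x = y = 1\<close>. On such a side
  the condition becomes linear.
\<close>
lemma side_fits_mixed:
  assumes "side_fits L p x q y" and "1 \<le> x" "y \<le> 1"
  shows "p * x + q * y + x + y - 1 \<le> L"
proof -
  have "(x + y - 1)\<^sup>2 = x\<^sup>2 + y\<^sup>2 - 1 - 2 * ((x - 1) * (1 - y))"
    by (simp add: power2_eq_square algebra_simps)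
  moreover have "0 \<le> (x - 1) * (1 - y)" using assms by simp
  ultimately show ?thesis using side_fits_bound[OF assms(1), of "x + y - 1"] by simp
qed

text \<open>
  The corners in cyclic order are cut with areas \<open>p\<^sup>2\<close>, \<open>q\<^sup>2\<close>, \<open>r\<^sup>2\<close> and ratios \<open>a\<close>, \<open>b\<close>, \<open>c\<close>: the first cut takes \<open>p a\<close> from
  one side and \<open>p a'\<close> from the next, and so on. Primed variables are reciprocals, kept as separate arguments so that a reflection of the triangle just
  permutes the arguments.
\<close>
definition cut_triangle ::
  "real \<Rightarrow> real \<Rightarrow> real \<Rightarrow> real \<Rightarrow> real \<Rightarrow> real \<Rightarrow> real \<Rightarrow> real \<Rightarrow> real \<Rightarrow> real \<Rightarrow> bool" where
  "cut_triangle L p a a' q b b' r c c' \<longleftrightarrow>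
     0 < a \<and> 0 < b \<and> 0 < c \<and> a * a' = 1 \<and> b * b' = 1 \<and> c * c' = 1 \<and>
     1 \<le> p \<and> 1 \<le> q \<and> 1 \<le> r \<and>
     side_fits L p a r c' \<and> side_fits L q b p a' \<and> side_fits L r c q b'"

lemma cut_triangle_rotate:
  "cut_triangle L p a a' q b b' r c c' \<Longrightarrow> cut_triangle L q b b' r c c' p a a'"
  by (auto simp: cut_triangle_def)

lemma cut_triangle_mirror:
  assumes "cut_triangle L p a a' q b b' r c c'"
  shows "cut_triangle L p a' a r c' c q b' b"
proof -
  have "0 < a'" "0 < b'" "0 < c'"
    using assms unfolding cut_triangle_def by (metis zero_less_mult_pos zero_less_one)+
  then show ?thesis using assms unfolding cut_triangle_def
    by (auto simp: side_fits_commute mult.commute)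
qed

lemma cut_triangle_inverse_pos:
  assumes "cut_triangle L p a a' q b b' r c c'"
  shows "0 < a'" "0 < b'" "0 < c'"
  using assms unfolding cut_triangle_def by (metis zero_less_mult_pos zero_less_one)+

lemma one_le_reciprocal_iff:
  fixes x y :: real assumes "x * y = 1" "0 < x" shows "1 \<le> x \<longleftrightarrow> y \<le> 1"
proof -
  have "y = 1 / x" using assms by (simp add: field_simps)
  then show ?thesis using assms by (simp add: divide_le_eq)
qed

text \<open>
  The next lemmas treat all cuts of area \<open>1\<close> except for one of area \<open>p\<^sup>2\<close>, according to which ratios
  exceed \<open>1\<close>. Here both ratios on one side at the large corner are at least \<open>1\<close>, and this side alone
  forces \<open>p + 2 \<le> L\<close>.
\<close>
lemma one_large_corner_next:
  assumes T: "cut_triangle L p a a' 1 b b' 1 c c'" and "1 \<le> a'" "1 \<le> b"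
  shows "8 + p\<^sup>2 \<le> L\<^sup>2"
proof -
  have T': "side_fits L 1 b p a'" "1 \<le> p" 
    using T by (auto simp: cut_triangle_def)
  have "b + p * a' + b \<le> L" using side_fits_ge_one[OF T'(1)] assms by simp
  moreover have "p * 1 \<le> p * a'" using assms T' by (intro mult_left_mono) auto
  ultimately have "p + 2 \<le> L" using assms by simp
  then have "(p + 2)\<^sup>2 \<le> L\<^sup>2" using T' by (intro power_mono) auto
  then show ?thesis using T' by (simp add: power2_eq_square algebra_simps)
qed

text \<open>
  Both small corners take more from the side opposite to the large corner. That side yields \<open>2 c + 1 \<le> L\<close>,
  the side between the corners \<open>p\<close> and \<open>r\<close> yields \<open>p + 2 / c \<le> L\<close>, and these cannot both hold if \<open>L\<close> is small.
\<close>
lemma one_large_corner_outside: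
  assumes T: "cut_triangle L p a a' 1 b b' 1 c c'" and "c' \<le> 1" "b \<le> 1" "1 \<le> a"
  shows "8 + p\<^sup>2 \<le> L\<^sup>2"
proof -
  have T': "side_fits L p a 1 c'" "side_fits L 1 c 1 b'" "1 \<le> p" "c * c' = 1" "0 < c" "0 < c'"
      "b' \<ge> 1"
    using T cut_triangle_inverse_pos[OF T] assms(3) one_le_reciprocal_iff[of b' b]
    by (auto simp: cut_triangle_def mult.commute)
  have "p * a + c' + a + c' - 1 \<le> L"
    using side_fits_mixed[OF T'(1)] assms by simp
  moreover have "p * 1 \<le> p * a" using assms T' by (intro mult_left_mono) auto
  ultimately have 1: "p + 2 * c' \<le> L" using assms by simp
  have 2: "2 * c + 1 \<le> L"
    using side_fits_ge_one[OF T'(2)] T' by simp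
  define R where "R = sqrt (8 + p\<^sup>2)"
  have R2: "R\<^sup>2 = 8 + p\<^sup>2" by (simp add: R_def)
  have Rp: "p < R" using T' by (auto simp: R_def intro: real_less_rsqrt)
  have R_le: "R \<le> p + 2"
    using T' unfolding R_def by (intro real_le_lsqrt) (auto simp: power2_eq_square algebra_simps)
  have "R \<le> L"
  proof (rule ccontr)
    assume "\<not> R \<le> L"
    then have a: "2 * c' < R - p" and b: "2 * c < R - 1" using 1 2 by auto
    have "2 * c < 1 + p" using b R_le by simp
    then have "2 * c + 2 * c < R + p" using b by simp
    then have "(2 * c') * (4 * c) < (R - p) * (R + p)"
      using a T' Rp by (intro mult_strict_mono) auto
    also have "\<dots> = 8" using R2 by (simp add: power2_eq_square algebra_simps)
    finally show False using T'(4) by (simp add: mult.commute)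
  qed
  then have "R\<^sup>2 \<le> L\<^sup>2" using Rp T' by (intro power_mono) auto
  then show ?thesis using R2 by simp
qed

text \<open>
  The ratios turn consistently around the triangle, so all three sides are of the mixed kind. Adding
  \<open>1\<close> to \<open>L\<close> and to \<open>p\<close> turns the three linear conditions into those for three cuts of areas
  \<open>P\<^sup>2, 4, 4\<close> that do not overlap on the sides of a triangle of area \<open>M\<^sup>2\<close>.
\<close>
lemma one_large_corner_twisted:
  assumes T: "cut_triangle L p a a' 1 b b' 1 c c'" and "c' \<le> 1" "1 \<le> b" "1 \<le> a"
  shows "8 + p\<^sup>2 \<le> L\<^sup>2"
proof -
  have T': "side_fits L p a 1 c'" "side_fits L 1 b p a'" "side_fits L 1 c 1 b'" "1 \<le> p"
      "a * a' = 1" "b * b' = 1" "c * c' = 1" "0 < c" "0 < c'" "0 < a" "0 < a'" "0 < b" "0 < b'"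
      "b' \<le> 1" "1 \<le> c" "a' \<le> 1"
    using T cut_triangle_inverse_pos[OF T] assms(2,3,4) one_le_reciprocal_iff[of b b']
      one_le_reciprocal_iff[of c c'] one_le_reciprocal_iff[of a a']
    by (auto simp: cut_triangle_def)
  define M where "M = L + 1"
  define P where "P = p + 1"
  have s1: "P * a \<le> M - 2 * c'"
    using side_fits_mixed[OF T'(1)] assms by (simp add: M_def P_def algebra_simps)
  have s2: "P * a' \<le> M - 2 * b"
    using side_fits_mixed[OF T'(2)] assms T' by (simp add: M_def P_def algebra_simps)
  have s3: "2 * (c + b') \<le> M"
    using side_fits_mixed[OF T'(3)] assms T' by (simp add: M_def algebra_simps)
  have P: "2 \<le> P" using T' by (simp add: P_def)
  define \<sigma> where "\<sigma> = b + c'"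
  have pos: "0 < P * a" "0 < P * a'" using P T' by auto
  have \<sigma>M: "\<sigma> < M" using s1 s2 pos by (simp add: \<sigma>_def)
  have \<sigma>0: "0 < \<sigma>" using T' by (simp add: \<sigma>_def)
  have "(P * a) * (P * a') = P\<^sup>2 * (a * a')" by (simp add: power2_eq_square)
  then have "P\<^sup>2 = (P * a) * (P * a')" using T'(5) by simp
  also have "\<dots> \<le> (M - 2 * c') * (M - 2 * b)" using s1 s2 pos
    by (intro mult_mono) linarith+
  also have "\<dots> = (M - \<sigma>)\<^sup>2 - (b - c')\<^sup>2"
    unfolding \<sigma>_def by (simp add: power2_eq_square algebra_simps)
  also have "\<dots> \<le> (M - \<sigma>)\<^sup>2" by simp
  finally have "P\<^sup>2 \<le> (M - \<sigma>)\<^sup>2" .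
  then have PM: "P \<le> M - \<sigma>" using power2_le_imp_le[of P "M - \<sigma>"] \<sigma>M by simp
  \<comment> \<open>The small cuts leave room on their common side only if they take a lot from the other two sides.\<close>
  have "8 \<le> M * \<sigma>"
  proof -
    have "c * b + b' * c' \<ge> 2"
    proof -
      have "(c * b) * (b' * c') = (b * b') * (c * c')" by simp
      then have e: "(c * b) * (b' * c') = 1" using T'(6,7) by simp
      have "(c * b + b' * c')\<^sup>2 = (c * b - b' * c')\<^sup>2 + 4 * ((c * b) * (b' * c'))"
        by (simp add: power2_eq_square algebra_simps)
      then have "2\<^sup>2 \<le> (c * b + b' * c')\<^sup>2" using e by simp
      then show ?thesis using power2_le_imp_le[of 2 "c * b + b' * c'"] T' by simp
    qed
    then have "4 \<le> (c + b') * \<sigma>" using T'(6,7) by (simp add: \<sigma>_def algebra_simps)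
    moreover have "(2 * (c + b')) * \<sigma> \<le> M * \<sigma>" using s3 \<sigma>0 by (intro mult_right_mono) auto
    ultimately show ?thesis by (simp only: mult.assoc)
  qed
  then have q: "8 / M \<le> \<sigma>" using \<sigma>M \<sigma>0 by (simp add: field_simps)
  define N where "N = M - \<sigma>"
  have M0: "M > 0" using \<sigma>M \<sigma>0 by simp
  have PN: "P\<^sup>2 - 2 * P \<le> N\<^sup>2 - 2 * N"
  proof -
    have "(P - 1)\<^sup>2 \<le> (N - 1)\<^sup>2" using PM P by (intro power_mono) (auto simp: N_def)
    then show ?thesis by (simp add: power2_eq_square algebra_simps)
  qed
  have M4: "4 \<le> M"
  proof (rule ccontr)
    assume "\<not> 4 \<le> M"
    then have "2 * M < 8" by simp
    moreover have "M * \<sigma> \<le> M * (M - 2)" using PM P M0 by (intro mult_left_mono) auto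
    then have "8 \<le> M * (M - 2)" using \<open>8 \<le> M * \<sigma>\<close> by linarith
    moreover have "M * (M - 2) \<le> 4 * (M - 2)" using \<open>\<not> 4 \<le> M\<close> PM P \<sigma>0 by (intro mult_right_mono) auto
    ultimately show False by simp
  qed
  have "M\<^sup>2 - 2 * M - (N\<^sup>2 - 2 * N) = \<sigma> * (2 * M - \<sigma> - 2)"
    by (simp add: N_def power2_eq_square algebra_simps)
  also have "\<dots> \<ge> 8"
  proof -
    have "\<sigma> \<le> M - 2" using PM P by simp
    define k where "k = 8 / M"
    have k: "k \<le> \<sigma>" "k * M = 8" "0 < k" "k \<le> 2" using q M0 M4 by (auto simp: k_def divide_le_eq)
    have "\<sigma> * (2 * M - \<sigma> - 2) - k * (2 * M - k - 2) = (\<sigma> - k) * (2 * M - 2 - \<sigma> - k)"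
      by (simp add: algebra_simps)
    also have "\<dots> \<ge> 0" using k \<open>\<sigma> \<le> M - 2\<close> M4 by (intro mult_nonneg_nonneg) auto
    finally have "k * (2 * M - k - 2) \<le> \<sigma> * (2 * M - \<sigma> - 2)" by simp
    moreover have "k * (2 * M - k - 2) = 16 - k * (k + 2)" using k(2) by (simp add: algebra_simps)
    moreover have "k * (k + 2) \<le> 2 * (2 + 2)" using k by (intro mult_mono) auto
    ultimately show ?thesis by simp
  qed
  finally have "8 + (P\<^sup>2 - 2 * P) \<le> M\<^sup>2 - 2 * M" using PN by simp
  then show ?thesis by (simp add: P_def M_def power2_eq_square algebra_simps)
qed

lemma one_large_corner:
  assumes T: "cut_triangle L p a a' 1 b b' 1 c c'"
  shows "8 + p\<^sup>2 \<le> L\<^sup>2"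
proof -
  have *: "8 + p\<^sup>2 \<le> L\<^sup>2" if T: "cut_triangle L p a a' 1 b b' 1 c c'" and "1 \<le> a" for a a' b b' c c'
  proof -
    note M = cut_triangle_mirror[OF T]
    consider "1 \<le> c'" | "c' \<le> 1" "1 \<le> b" | "c' \<le> 1" "b \<le> 1" by linarith
    then show ?thesis
    proof cases
      case 1 then show ?thesis using one_large_corner_next[OF M] \<open>1 \<le> a\<close> by simp
    next
      case 2 then show ?thesis using one_large_corner_twisted[OF T] \<open>1 \<le> a\<close> by simp
    next
      case 3 then show ?thesis using one_large_corner_outside[OF T] \<open>1 \<le> a\<close> by simp
    qed
  qed
  have "a * a' = 1" "0 < a" using T by (auto simp: cut_triangle_def)
  then have "1 \<le> a \<or> 1 \<le> a'" using one_le_reciprocal_iff[of a a'] by linarith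
  then show ?thesis using *[OF T] *[OF cut_triangle_mirror[OF T]] by auto
qed

text \<open>
  This is the inward parallel motion of the edge that lies on the side between the corners \<open>p\<close> and \<open>q\<close>. It
  shrinks the triangle and these two cuts, but keeps the rests of the two other sides. The remaining
  edge on the moved side becomes longer when it has a cap; when it has none, the other two sides
  guarantee that it does not vanish. The motion stops when one of the two corners has area \<open>1\<close>.
\<close>
lemma shrink_two_corners:
  assumes T: "cut_triangle L p a a' q b b' r c c'"
  obtains L' p' q' where "cut_triangle L' p' a a' q' b b' r c c'" "p' = 1 \<or> q' = 1"
    "L'\<^sup>2 - p'\<^sup>2 - q'\<^sup>2 \<le> L\<^sup>2 - p\<^sup>2 - q\<^sup>2"
proof -
  note pos = cut_triangle_inverse_pos[OF T]
  have T': "0 < a" "0 < b" "0 < c" "a * a' = 1" "b * b' = 1" "c * c' = 1" "1 \<le> p" "1 \<le> q" "1 \<le> r"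
     "side_fits L p a r c'" "side_fits L q b p a'" "side_fits L r c q b'"
    using T by (auto simp: cut_triangle_def)
  define t where "t = min ((p - 1) * a) ((q - 1) * b')"
  define p' where "p' = p - t * a'"
  define q' where "q' = q - t * b"
  define L' where "L' = L - t"
  have t0: "0 \<le> t" using T' pos by (simp add: t_def)
  have ta: "t * a' \<le> p - 1"
  proof -
    have "t * a' \<le> (p - 1) * a * a'" using pos by (intro mult_right_mono) (auto simp: t_def)
    then show ?thesis using T'(4) by (simp add: mult.assoc)
  qed
  have tb: "t * b \<le> q - 1"
  proof -
    have "t * b \<le> (q - 1) * b' * b" using T' by (intro mult_right_mono) (auto simp: t_def)
    then show ?thesis using T'(5) by (simp add: mult.assoc mult.commute[of b'])
  qed
  have p': "1 \<le> p'" and q': "1 \<le> q'" using ta tb by (auto simp: p'_def q'_def)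
  have one: "p' = 1 \<or> q' = 1"
  proof (cases "(p - 1) * a \<le> (q - 1) * b'")
    case True
    then have "t * a' = (p - 1) * (a * a')" by (simp add: t_def)
    then show ?thesis using T'(4) by (simp add: p'_def)
  next
    case False
    then have "t * b = (q - 1) * (b * b')" by (simp add: t_def)
    then show ?thesis using T'(5) by (simp add: q'_def)
  qed
  have e1: "L' - p' * a = L - p * a" 
    using T'(4) by (simp add: L'_def p'_def left_diff_distrib mult.assoc mult.commute[of a'])
  have e3: "L' - q' * b' = L - q * b'" 
    using T'(5) by (simp add: L'_def q'_def left_diff_distrib mult.assoc)
  have S1: "side_fits L' p' a r c'" using T'(10) e1 unfolding side_fits_def by (smt (verit))
  have S3: "side_fits L' r c q' b'" using T'(12) e3 unfolding side_fits_def by (smt (verit))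
  define \<kappa> where "\<kappa> = b\<^sup>2 + a'\<^sup>2 - 1"
  define \<delta> where "\<delta> = L - q * b - p * a'"
  have e2: "L' - q' * b - p' * a' = \<delta> + t * \<kappa>"
    by (simp add: L'_def q'_def p'_def \<delta>_def \<kappa>_def power2_eq_square algebra_simps)
  have \<delta>: "0 \<le> \<delta>" "\<kappa> \<le> \<delta>\<^sup>2" using T'(11) by (auto simp: side_fits_def \<delta>_def \<kappa>_def)
  have h: "L'\<^sup>2 - p'\<^sup>2 - q'\<^sup>2 = L\<^sup>2 - p\<^sup>2 - q\<^sup>2 - t * \<delta> - t * (\<delta> + t * \<kappa>)"
    by (simp add: L'_def q'_def p'_def \<delta>_def \<kappa>_def power2_eq_square algebra_simps)
  \<comment> \<open>\<open>\<delta>\<close> is the length that remains on the moved side; \<open>\<kappa>\<close> is positive exactly if its edge has a cap.\<close>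
  have slack: "0 \<le> \<delta> + t * \<kappa>"
  proof (cases "0 \<le> \<kappa>")
    case True then show ?thesis using \<delta> t0 by simp
  next
    case False
    have "p' * a \<le> L'" "q' * b' \<le> L'" using S1 S3 T' pos unfolding side_fits_def
      by (smt (verit) mult_pos_pos)+
    then have "p' * a * a'\<^sup>2 \<le> L' * a'\<^sup>2" "q' * b' * b\<^sup>2 \<le> L' * b\<^sup>2" by (auto intro: mult_right_mono)
    moreover have "p' * a * a'\<^sup>2 = p' * a' * (a * a')" "q' * b' * b\<^sup>2 = q' * b * (b * b')"
      by (simp_all add: power2_eq_square)
    then have "p' * a * a'\<^sup>2 = p' * a'" "q' * b' * b\<^sup>2 = q' * b" using T'(4,5) by simp_all
    ultimately have "q' * b + p' * a' \<le> L' * a'\<^sup>2 + L' * b\<^sup>2" by linarith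
    then have "q' * b + p' * a' \<le> L' * (1 + \<kappa>)" by (simp add: \<kappa>_def algebra_simps)
    also have "\<dots> \<le> L' * 1"
    proof (intro mult_left_mono)
      show "0 \<le> L'" using \<open>p' * a \<le> L'\<close> p' T'(1) by (smt (verit) mult_nonneg_nonneg)
    qed (use False in auto)
    finally show ?thesis using e2 by simp
  qed
  have S2: "side_fits L' q' b p' a'"
  proof -
    have "\<kappa> \<le> (\<delta> + t * \<kappa>)\<^sup>2"
    proof (cases "0 \<le> \<kappa>")
      case True
      then have "\<delta>\<^sup>2 \<le> (\<delta> + t * \<kappa>)\<^sup>2" using \<delta> t0 by (intro power_mono) auto
      then show ?thesis using \<delta> by simp
    next
      case False then show ?thesis by (smt (verit) zero_le_power2)
    qed
    then show ?thesis using slack unfolding side_fits_def e2 \<kappa>_def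
      using e2 by (simp add: \<kappa>_def)
  qed
  have "cut_triangle L' p' a a' q' b b' r c c'"
    using T' p' q' S1 S2 S3 by (simp add: cut_triangle_def)
  moreover have "L'\<^sup>2 - p'\<^sup>2 - q'\<^sup>2 \<le> L\<^sup>2 - p\<^sup>2 - q\<^sup>2"
    using h \<delta> t0 slack by (smt (verit) mult_nonneg_nonneg)
  ultimately show ?thesis using one by (intro that)
qed

lemma cut_triangle_area:
  assumes T: "cut_triangle L p a a' q b b' r c c'"
  shows "6 + p\<^sup>2 + q\<^sup>2 + r\<^sup>2 \<le> L\<^sup>2"
proof -
  have *: "6 + p\<^sup>2 + q\<^sup>2 + r\<^sup>2 \<le> L\<^sup>2" if T: "cut_triangle L p a a' q b b' r c c'" and q: "q = 1"
    for L p a a' q b b' r c c'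
  proof -
    from shrink_two_corners[OF cut_triangle_rotate[OF cut_triangle_rotate[OF T]]] obtain L' r' p' where
      T': "cut_triangle L' r' c c' p' a a' q b b'" and "r' = 1 \<or> p' = 1" and
      le: "L'\<^sup>2 - r'\<^sup>2 - p'\<^sup>2 \<le> L\<^sup>2 - r\<^sup>2 - p\<^sup>2" by blast
    then consider "r' = 1" | "p' = 1" by blast
    then have "7 + r'\<^sup>2 + p'\<^sup>2 \<le> L'\<^sup>2"
    proof cases
      case 1
      then show ?thesis using one_large_corner[OF cut_triangle_rotate[OF T'[unfolded q 1]]] by simp
    next
      case 2
      then show ?thesis using one_large_corner[OF T'[unfolded q 2]] by simp
    qed
    then show ?thesis using le q by simp
  qed
  from shrink_two_corners[OF T] obtain L' p' q' where
      T': "cut_triangle L' p' a a' q' b b' r c c'" and "p' = 1 \<or> q' = 1" and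
      le: "L'\<^sup>2 - p'\<^sup>2 - q'\<^sup>2 \<le> L\<^sup>2 - p\<^sup>2 - q\<^sup>2" by blast
  then consider "p' = 1" | "q' = 1" by blast
  then have "6 + p'\<^sup>2 + q'\<^sup>2 + r\<^sup>2 \<le> L'\<^sup>2"
  proof cases
    case 1
    then show ?thesis
      using *[OF cut_triangle_rotate[OF cut_triangle_rotate[OF T']]] by simp
  next
    case 2
    then show ?thesis using *[OF T'] by simp
  qed
  then show ?thesis using le by simp
qed
text \<open>
  The same inequality in terms of the fractions in which the cuts divide the sides, for a triangle whose
  area is \<open>\<rho>\<close> times the prescribed cap area.
\<close>
lemma truncated_triangle_area:
  fixes u1 u2 v1 v2 w1 w2 \<rho> :: real
  assumes pos: "0 < u1" "0 < u2" "0 < v1" "0 < v2" "0 < w1" "0 < w2" "0 < \<rho>"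
    and room: "u1 + w2 \<le> 1" "v1 + u2 \<le> 1" "w1 + v2 \<le> 1"
    and corners: "1 \<le> \<rho> * (u1 * u2)" "1 \<le> \<rho> * (v1 * v2)" "1 \<le> \<rho> * (w1 * w2)"
    and sides: "u1 / u2 + w2 / w1 - 1 \<le> \<rho> * (1 - u1 - w2)\<^sup>2"
      "v1 / v2 + u2 / u1 - 1 \<le> \<rho> * (1 - v1 - u2)\<^sup>2"
      "w1 / w2 + v2 / v1 - 1 \<le> \<rho> * (1 - w1 - v2)\<^sup>2"
  shows "6 \<le> \<rho> * (1 - u1 * u2 - v1 * v2 - w1 * w2)"
proof -
  define L where "L = sqrt \<rho>"
  have L2: "L\<^sup>2 = \<rho>" using pos by (simp add: L_def)
  have split: "sqrt (\<rho> * (x * y)) * sqrt (x / y) = L * x" if "0 < x" "0 < y" for x y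
  proof -
    have "sqrt (\<rho> * (x * y)) * sqrt (x / y) = sqrt (\<rho> * x\<^sup>2)"
      unfolding real_sqrt_mult[symmetric] using that by (simp add: power2_eq_square)
    then show ?thesis using that by (simp add: real_sqrt_mult L_def)
  qed
  have split': "sqrt (\<rho> * (x * y)) * sqrt (y / x) = L * y" if "0 < x" "0 < y" for x y
    using split[of y x] that by (simp add: mult.commute)
  have side: "side_fits L (sqrt (\<rho> * (x * x'))) (sqrt (x / x')) (sqrt (\<rho> * (y' * y))) (sqrt (y / y'))"
    if "0 < x" "0 < x'" "0 < y" "0 < y'" "x + y \<le> 1" "x / x' + y / y' - 1 \<le> \<rho> * (1 - x - y)\<^sup>2"
    for x x' y y'
  proof -
    have "L - L * x - L * y = L * (1 - x - y)" by (simp add: algebra_simps)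
    moreover have "0 \<le> L * (1 - x - y)" using that pos by (simp add: L_def)
    ultimately show ?thesis using that
      by (simp add: side_fits_def split split' power_mult_distrib L2)
  qed
  have "cut_triangle L (sqrt (\<rho> * (u1 * u2))) (sqrt (u1 / u2)) (sqrt (u2 / u1))
      (sqrt (\<rho> * (v1 * v2))) (sqrt (v1 / v2)) (sqrt (v2 / v1))
      (sqrt (\<rho> * (w1 * w2))) (sqrt (w1 / w2)) (sqrt (w2 / w1))"
    unfolding cut_triangle_def
    using pos corners side[of u1 u2 w2 w1] side[of v1 v2 u2 u1] side[of w1 w2 v2 v1] room sides
    by (simp add: real_sqrt_mult[symmetric])
  from cut_triangle_area[OF this] show ?thesis
    using pos by (simp add: L2 algebra_simps)
qed

section \<open>Cross products in the plane\<close>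

definition cross :: "real^2 \<Rightarrow> real^2 \<Rightarrow> real" (infixl "\<otimes>" 70) where
  "a \<otimes> b = a $ 1 * b $ 2 - a $ 2 * b $ 1"

lemma cross_simps:
  "(a + b) \<otimes> c = a \<otimes> c + b \<otimes> c" "c \<otimes> (a + b) = c \<otimes> a + c \<otimes> b"
  "(a - b) \<otimes> c = a \<otimes> c - b \<otimes> c" "c \<otimes> (a - b) = c \<otimes> a - c \<otimes> b"
  "(k *\<^sub>R a) \<otimes> c = k * (a \<otimes> c)" "c \<otimes> (k *\<^sub>R a) = k * (c \<otimes> a)"
  "(- a) \<otimes> c = - (a \<otimes> c)" "c \<otimes> (- a) = - (c \<otimes> a)"
  "a \<otimes> a = 0" "0 \<otimes> a = 0" "a \<otimes> 0 = 0"
  by (simp_all add: cross_def algebra_simps)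

lemma cross_swap: "b \<otimes> a = - (a \<otimes> b)"
  by (simp add: cross_def)

lemma cross_relation:
  "(a \<otimes> b) * (c \<otimes> d) - (a \<otimes> c) * (b \<otimes> d) + (a \<otimes> d) * (b \<otimes> c) = 0"
  by (simp add: cross_def algebra_simps)

text \<open>
  Cramer's rule in the plane.
\<close>
lemma cross_coordinates:
  assumes "a \<otimes> c \<noteq> 0"
  shows "b = ((b \<otimes> c) / (a \<otimes> c)) *\<^sub>R a + ((a \<otimes> b) / (a \<otimes> c)) *\<^sub>R c"
proof -
  have "(a \<otimes> c) *\<^sub>R b = (b \<otimes> c) *\<^sub>R a + (a \<otimes> b) *\<^sub>R c"
    by (simp add: cross_def vec_eq_iff forall_2 algebra_simps)
  then have "b = (1 / (a \<otimes> c)) *\<^sub>R ((b \<otimes> c) *\<^sub>R a + (a \<otimes> b) *\<^sub>R c)"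
    using assms by (metis divideR_right scaleR_conv_of_real scaleR_one inverse_eq_divide)
  then show ?thesis by (simp add: scaleR_add_right)
qed

section \<open>A hexagon has area at least six times its smallest cap\<close>

text \<open>
  The edge vectors of a convex hexagon in counterclockwise order. The inequalities say
  that the triangles on three consecutive vertices, and those on an edge and a vertex at distance two from
  it, are positively oriented.
\<close>
definition hexagon_edges ::
  "real^2 \<Rightarrow> real^2 \<Rightarrow> real^2 \<Rightarrow> real^2 \<Rightarrow> real^2 \<Rightarrow> real^2 \<Rightarrow> bool" where
  "hexagon_edges a b c d e f \<longleftrightarrow> a + b + c + d + e + f = 0 \<and>
     0 < a \<otimes> b \<and> 0 < b \<otimes> c \<and> 0 < c \<otimes> d \<and> 0 < d \<otimes> e \<and> 0 < e \<otimes> f \<and> 0 < f \<otimes> a \<and>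
     0 < a \<otimes> (b + c) \<and> 0 < b \<otimes> (c + d) \<and> 0 < c \<otimes> (d + e) \<and>
     0 < d \<otimes> (e + f) \<and> 0 < e \<otimes> (f + a) \<and> 0 < f \<otimes> (a + b) \<and>
     0 < (a + b) \<otimes> c \<and> 0 < (b + c) \<otimes> d \<and> 0 < (c + d) \<otimes> e \<and>
     0 < (d + e) \<otimes> f \<and> 0 < (e + f) \<otimes> a \<and> 0 < (f + a) \<otimes> b"

lemma hexagon_edges_rotate: "hexagon_edges a b c d e f \<Longrightarrow> hexagon_edges b c d e f a"
  by (simp add: hexagon_edges_def add_ac)

text \<open>
  Twice the area: three triangles cut off at every second vertex, and the triangle on the remaining
  vertices.
\<close>
definition hexagon_area2 ::
  "real^2 \<Rightarrow> real^2 \<Rightarrow> real^2 \<Rightarrow> real^2 \<Rightarrow> real^2 \<Rightarrow> real^2 \<Rightarrow> real" where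
  "hexagon_area2 a b c d e f = a \<otimes> b + c \<otimes> d + e \<otimes> f + (a + b) \<otimes> (c + d)"

lemma hexagon_area2_rotate:
  assumes "hexagon_edges a b c d e f"
  shows "hexagon_area2 b c d e f a = hexagon_area2 a b c d e f"
proof -
  have f: "f = - a - b - c - d - e" using assms by (simp add: hexagon_edges_def algebra_simps eq_neg_iff_add_eq_0)
  show ?thesis unfolding f hexagon_area2_def by (simp add: cross_def algebra_simps)
qed

text \<open>
  If edges \<open>u, v, w\<close> follow each other and \<open>0 < u \<otimes> w\<close>, then the cap of \<open>v\<close> has doubled area
  \<open>(u \<otimes> v) (v \<otimes> w) / (u \<otimes> w)\<close>. If \<open>u \<otimes> w \<le> 0\<close>, then \<open>v\<close> has no cap and the inequality below holds trivially.
\<close>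
definition large_caps ::
  "real \<Rightarrow> real^2 \<Rightarrow> real^2 \<Rightarrow> real^2 \<Rightarrow> real^2 \<Rightarrow> real^2 \<Rightarrow> real^2 \<Rightarrow> bool" where
  "large_caps \<mu> a b c d e f \<longleftrightarrow>
     \<mu> * (f \<otimes> b) \<le> (f \<otimes> a) * (a \<otimes> b) \<and> \<mu> * (a \<otimes> c) \<le> (a \<otimes> b) * (b \<otimes> c) \<and>
     \<mu> * (b \<otimes> d) \<le> (b \<otimes> c) * (c \<otimes> d) \<and> \<mu> * (c \<otimes> e) \<le> (c \<otimes> d) * (d \<otimes> e) \<and>
     \<mu> * (d \<otimes> f) \<le> (d \<otimes> e) * (e \<otimes> f) \<and> \<mu> * (e \<otimes> a) \<le> (e \<otimes> f) * (f \<otimes> a)"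

lemma large_caps_rotate: "large_caps \<mu> a b c d e f \<Longrightarrow> large_caps \<mu> b c d e f a"
  by (simp add: large_caps_def)

text \<open>
  The edges \<open>e1\<close>, \<open>e3\<close>, \<open>e5\<close> span a triangle, from which \<open>e2\<close>, \<open>e4\<close>, \<open>e6\<close> cut the corners. The vectors
  \<open>\<Phi>1 e1\<close>, \<open>\<Phi>3 e3\<close>, \<open>\<Phi>5 e5\<close> are its sides, of common doubled area \<open>\<delta> \<Phi>1 \<Phi>3 \<Phi>5\<close>, and all quantities become
  polynomials in the coordinates of the cutting edges.
\<close>
lemma area2_ge_between_three_lines:
  assumes hex: "hexagon_edges e1 e2 e3 e4 e5 e6" and large: "large_caps \<mu> e1 e2 e3 e4 e5 e6" and "0 < \<mu>"
    and D: "0 < e1 \<otimes> e3" "0 < e3 \<otimes> e5" "0 < e5 \<otimes> e1"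
  shows "6 * \<mu> \<le> hexagon_area2 e1 e2 e3 e4 e5 e6"
proof -
  define s where "s = (e2 \<otimes> e3) / (e1 \<otimes> e3)"
  define t where "t = (e1 \<otimes> e2) / (e1 \<otimes> e3)"
  define s' where "s' = (e4 \<otimes> e5) / (e3 \<otimes> e5)"
  define t' where "t' = (e3 \<otimes> e4) / (e3 \<otimes> e5)"
  define s'' where "s'' = (e6 \<otimes> e1) / (e5 \<otimes> e1)"
  define t'' where "t'' = (e5 \<otimes> e6) / (e5 \<otimes> e1)"
  have pos: "0 < s" "0 < t" "0 < s'" "0 < t'" "0 < s''" "0 < t''"
    using hex D by (simp_all add: hexagon_edges_def s_def t_def s'_def t'_def s''_def t''_def)
  have e2: "e2 = s *\<^sub>R e1 + t *\<^sub>R e3" unfolding s_def t_def using D by (intro cross_coordinates) auto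
  have e4: "e4 = s' *\<^sub>R e3 + t' *\<^sub>R e5" unfolding s'_def t'_def using D by (intro cross_coordinates) auto
  have e6: "e6 = s'' *\<^sub>R e5 + t'' *\<^sub>R e1" unfolding s''_def t''_def using D by (intro cross_coordinates) auto
  define \<Phi>1 where "\<Phi>1 = 1 + s + t''"
  define \<Phi>3 where "\<Phi>3 = 1 + s' + t"
  define \<Phi>5 where "\<Phi>5 = 1 + s'' + t'"
  have \<Phi>: "0 < \<Phi>1" "0 < \<Phi>3" "0 < \<Phi>5" using pos by (simp_all add: \<Phi>1_def \<Phi>3_def \<Phi>5_def)
  have "e1 + e2 + e3 + e4 + e5 + e6 = 0" using hex by (simp add: hexagon_edges_def)
  then have closed: "\<Phi>1 *\<^sub>R e1 + \<Phi>3 *\<^sub>R e3 + \<Phi>5 *\<^sub>R e5 = 0"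
    unfolding e2 e4 e6 \<Phi>1_def \<Phi>3_def \<Phi>5_def by (simp add: algebra_simps)
  define \<delta> where "\<delta> = (e1 \<otimes> e3) / \<Phi>5"
  have \<delta>: "0 < \<delta>" using D \<Phi> by (simp add: \<delta>_def)
  have D13: "e1 \<otimes> e3 = \<delta> * \<Phi>5" using \<Phi> by (simp add: \<delta>_def)
  have "(\<Phi>1 *\<^sub>R e1 + \<Phi>3 *\<^sub>R e3 + \<Phi>5 *\<^sub>R e5) \<otimes> e3 = 0" "e1 \<otimes> (\<Phi>1 *\<^sub>R e1 + \<Phi>3 *\<^sub>R e3 + \<Phi>5 *\<^sub>R e5) = 0"
    unfolding closed by (simp_all add: cross_simps)
  then have "\<Phi>1 * (e1 \<otimes> e3) = \<Phi>5 * (e3 \<otimes> e5)" "\<Phi>3 * (e1 \<otimes> e3) = \<Phi>5 * (e5 \<otimes> e1)"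
    by (simp_all add: cross_simps cross_swap[of e3 e5] cross_swap[of e1 e5])
  then have D35: "e3 \<otimes> e5 = \<delta> * \<Phi>1" and D51: "e5 \<otimes> e1 = \<delta> * \<Phi>3"
    using \<Phi> by (simp_all add: \<delta>_def field_simps)
  have D': "e3 \<otimes> e1 = - (\<delta> * \<Phi>5)" "e5 \<otimes> e3 = - (\<delta> * \<Phi>1)" "e1 \<otimes> e5 = - (\<delta> * \<Phi>3)"
    using D13 D35 D51 cross_swap by metis+
  note cr = cross_simps D13 D35 D51 D'
  have q: "e1 \<otimes> e2 = t * (\<delta> * \<Phi>5)" "e2 \<otimes> e3 = s * (\<delta> * \<Phi>5)"
     "e3 \<otimes> e4 = t' * (\<delta> * \<Phi>1)" "e4 \<otimes> e5 = s' * (\<delta> * \<Phi>1)"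
     "e5 \<otimes> e6 = t'' * (\<delta> * \<Phi>3)" "e6 \<otimes> e1 = s'' * (\<delta> * \<Phi>3)"
    unfolding e2 e4 e6 by (simp_all add: cr)
  have d: "e6 \<otimes> e2 = \<delta> * (s'' * s * \<Phi>3 - s'' * t * \<Phi>1 + t'' * t * \<Phi>5)"
      "e2 \<otimes> e4 = \<delta> * (s * s' * \<Phi>5 - s * t' * \<Phi>3 + t * t' * \<Phi>1)"
      "e4 \<otimes> e6 = \<delta> * (s' * s'' * \<Phi>1 - s' * t'' * \<Phi>5 + t' * t'' * \<Phi>3)"
    unfolding e2 e4 e6 by (simp_all add: cr algebra_simps)
  have area: "hexagon_area2 e1 e2 e3 e4 e5 e6 =
      \<delta> * (\<Phi>1 * \<Phi>3 * \<Phi>5 - s * t * \<Phi>5 - s' * t' * \<Phi>1 - s'' * t'' * \<Phi>3)"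
  proof -
    have "(e1 + e2) \<otimes> (e3 + e4) = \<delta> * ((1 + s) * (1 + s') * \<Phi>5 - (1 + s) * t' * \<Phi>3 + t * t' * \<Phi>1)"
      unfolding e2 e4 by (simp add: cr algebra_simps)
    then show ?thesis unfolding hexagon_area2_def q
      by (simp add: \<Phi>1_def \<Phi>3_def \<Phi>5_def algebra_simps)
  qed
  define \<rho> where "\<rho> = \<delta> * \<Phi>1 * \<Phi>3 * \<Phi>5 / \<mu>"
  have "6 \<le> \<rho> * (1 - (s / \<Phi>1) * (t / \<Phi>3) - (s' / \<Phi>3) * (t' / \<Phi>5) - (s'' / \<Phi>5) * (t'' / \<Phi>1))"
  proof (rule truncated_triangle_area)
    have room: "1 - s / \<Phi>1 - t'' / \<Phi>1 = 1 / \<Phi>1" "1 - s' / \<Phi>3 - t / \<Phi>3 = 1 / \<Phi>3"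
       "1 - s'' / \<Phi>5 - t' / \<Phi>5 = 1 / \<Phi>5"
      using \<Phi> by (simp_all add: divide_simps) (simp_all add: \<Phi>1_def \<Phi>3_def \<Phi>5_def)
    show "s / \<Phi>1 + t'' / \<Phi>1 \<le> 1" "s' / \<Phi>3 + t / \<Phi>3 \<le> 1" "s'' / \<Phi>5 + t' / \<Phi>5 \<le> 1"
      using room \<Phi> zero_less_divide_1_iff[of \<Phi>1] zero_less_divide_1_iff[of \<Phi>3] zero_less_divide_1_iff[of \<Phi>5]
      by linarith+
    have corner: "1 \<le> \<delta> * \<Phi>1 * \<Phi>3 * \<Phi>5 / \<mu> * (x / \<Phi> * (y / \<Phi>'))"
      if "\<mu> * (\<delta> * \<Phi>'') \<le> (y * (\<delta> * \<Phi>'')) * (x * (\<delta> * \<Phi>''))" "0 < \<Phi>''" "0 < \<Phi>" "0 < \<Phi>'"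
        "\<Phi> * \<Phi>' * \<Phi>'' = \<Phi>1 * \<Phi>3 * \<Phi>5"
      for x y \<Phi> \<Phi>' \<Phi>''
    proof -
      have "\<mu> \<le> x * y * \<delta> * \<Phi>''"
      proof -
        have "\<mu> * (\<delta> * \<Phi>'') \<le> (x * y * \<delta> * \<Phi>'') * (\<delta> * \<Phi>'')" using that(1) by (simp add: algebra_simps)
        then show ?thesis using that(2) \<delta> by (simp add: mult_le_cancel_right)
      qed
      moreover have "\<delta> * \<Phi>1 * \<Phi>3 * \<Phi>5 / \<mu> * (x / \<Phi> * (y / \<Phi>')) = x * y * \<delta> * \<Phi>'' / \<mu>"
      proof -
        have e: "\<delta> * \<Phi>1 * \<Phi>3 * \<Phi>5 = \<delta> * (\<Phi> * \<Phi>' * \<Phi>'')" using that(5) by simp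
        show ?thesis unfolding e using that(3,4) \<open>0 < \<mu>\<close> by (simp add: field_simps)
      qed
      ultimately show ?thesis using \<open>0 < \<mu>\<close> by simp
    qed
    show "1 \<le> \<rho> * (s / \<Phi>1 * (t / \<Phi>3))" "1 \<le> \<rho> * (s' / \<Phi>3 * (t' / \<Phi>5))" "1 \<le> \<rho> * (s'' / \<Phi>5 * (t'' / \<Phi>1))"
      unfolding \<rho>_def using large \<Phi> unfolding large_caps_def q D13 D35 D51
      by (intro corner[where \<Phi>''=\<Phi>5] corner[where \<Phi>''=\<Phi>1] corner[where \<Phi>''=\<Phi>3]; simp)+
    have side: "(x / \<Phi>) / (x' / \<Phi>') + (y / \<Phi>) / (y' / \<Phi>'') - 1 \<le> \<delta> * \<Phi>1 * \<Phi>3 * \<Phi>5 / \<mu> * (1 / \<Phi>)\<^sup>2"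
      if "\<mu> * (\<delta> * (y' * x * \<Phi>' - y' * x' * \<Phi> + y * x' * \<Phi>'')) \<le> (y' * (\<delta> * \<Phi>')) * (x' * (\<delta> * \<Phi>''))"
        "0 < \<Phi>''" "0 < \<Phi>" "0 < \<Phi>'" "0 < x'" "0 < y'" "\<Phi> * \<Phi>' * \<Phi>'' = \<Phi>1 * \<Phi>3 * \<Phi>5"
      for x x' y y' \<Phi> \<Phi>' \<Phi>''
    proof -
      define z where "z = y' * x * \<Phi>' - y' * x' * \<Phi> + y * x' * \<Phi>''"
      have "(\<mu> * z) * \<delta> \<le> (x' * y' * \<delta> * \<Phi>' * \<Phi>'') * \<delta>"
        using that(1) by (simp add: z_def algebra_simps)
      then have "\<mu> * z \<le> x' * y' * \<delta> * \<Phi>' * \<Phi>''" using \<delta> by (simp add: mult_le_cancel_right)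
      then have "z / (x' * y' * \<Phi>) \<le> \<delta> * \<Phi>' * \<Phi>'' / (\<mu> * \<Phi>)"
        using that \<open>0 < \<mu>\<close> by (simp add: field_simps)
      moreover have "(x / \<Phi>) / (x' / \<Phi>') + (y / \<Phi>) / (y' / \<Phi>'') - 1 = z / (x' * y' * \<Phi>)"
        using that(2-6) by (simp add: z_def field_simps)
      moreover have "\<delta> * \<Phi>1 * \<Phi>3 * \<Phi>5 / \<mu> * (1 / \<Phi>)\<^sup>2 = \<delta> * \<Phi>' * \<Phi>'' / (\<mu> * \<Phi>)"
      proof -
        have e: "\<delta> * \<Phi>1 * \<Phi>3 * \<Phi>5 = \<delta> * (\<Phi> * \<Phi>' * \<Phi>'')" using that(7) by simp
        show ?thesis unfolding e using that(3) \<open>0 < \<mu>\<close> by (simp add: power2_eq_square)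
      qed
      ultimately show ?thesis by simp
    qed
    show "s / \<Phi>1 / (t / \<Phi>3) + t'' / \<Phi>1 / (s'' / \<Phi>5) - 1 \<le> \<rho> * (1 - s / \<Phi>1 - t'' / \<Phi>1)\<^sup>2"
      unfolding \<rho>_def room using large \<Phi> pos
      by (intro side) (simp_all add: large_caps_def q d algebra_simps)
    show "s' / \<Phi>3 / (t' / \<Phi>5) + t / \<Phi>3 / (s / \<Phi>1) - 1 \<le> \<rho> * (1 - s' / \<Phi>3 - t / \<Phi>3)\<^sup>2"
      unfolding \<rho>_def room using large \<Phi> pos
      by (intro side) (simp_all add: large_caps_def q d algebra_simps)
    show "s'' / \<Phi>5 / (t'' / \<Phi>1) + t' / \<Phi>5 / (s' / \<Phi>3) - 1 \<le> \<rho> * (1 - s'' / \<Phi>5 - t' / \<Phi>5)\<^sup>2"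
      unfolding \<rho>_def room using large \<Phi> pos
      by (intro side) (simp_all add: large_caps_def q d algebra_simps)
  qed (use pos \<Phi> \<delta> \<open>0 < \<mu>\<close> in \<open>auto simp: \<rho>_def\<close>)
  also have "\<rho> * (1 - (s / \<Phi>1) * (t / \<Phi>3) - (s' / \<Phi>3) * (t' / \<Phi>5) - (s'' / \<Phi>5) * (t'' / \<Phi>1))
      = hexagon_area2 e1 e2 e3 e4 e5 e6 / \<mu>"
    unfolding area \<rho>_def using \<Phi> \<open>0 < \<mu>\<close> by (simp add: field_simps)
  finally show ?thesis using \<open>0 < \<mu>\<close> by (simp add: pos_le_divide_eq)
qed

text \<open>
  As \<open>e1\<close> and \<open>e2\<close> have no caps, the chain \<open>e3, e4, e5, e6\<close> lies in a triangle of area at most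
  that of the triangle spanned by \<open>e1\<close> and \<open>e2\<close>, with doubled area \<open>e1 \<otimes> e2\<close>. Let \<open>m\<close> be the doubled area of the
  triangle on \<open>e4\<close> and \<open>e5\<close>. With \<open>X\<close> and \<open>Y\<close> as below, the doubled areas of the caps of \<open>e4\<close> and \<open>e5\<close> have
  the product \<open>(m Y / X)\<^sup>2\<close>, and \<open>6 m Y / X \<le> e1 \<otimes> e2 + m\<close>, which is at most the doubled area of the hexagon.
\<close>
lemma area2_ge_two_capless_edges:
  assumes hex: "hexagon_edges e1 e2 e3 e4 e5 e6" and large: "large_caps \<mu> e1 e2 e3 e4 e5 e6" and "0 < \<mu>"
    and D: "e6 \<otimes> e2 \<le> 0" "e1 \<otimes> e3 \<le> 0"
  shows "6 * \<mu> \<le> hexagon_area2 e1 e2 e3 e4 e5 e6"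
proof -
  have e1: "e1 = - e2 - e3 - e4 - e5 - e6"
    using hex by (simp add: hexagon_edges_def algebra_simps eq_neg_iff_add_eq_0)
  \<comment> \<open>The lines of \<open>e3\<close> and \<open>e6\<close> meet beyond the chain; \<open>N > 0\<close> expresses this.\<close>
  define N where "N = e3 \<otimes> e6"
  have \<alpha>1: "0 < e1 \<otimes> e3 + e2 \<otimes> e3" and \<alpha>2: "0 < e6 \<otimes> e1 + e6 \<otimes> e2"
    using hex by (simp_all add: hexagon_edges_def cross_simps)
  have q1: "0 < e1 \<otimes> e2" using hex by (simp add: hexagon_edges_def)
  have qN: "(e1 \<otimes> e2) * N = (e2 \<otimes> e3) * (e6 \<otimes> e1) - (e6 \<otimes> e2) * (e1 \<otimes> e3)"
    by (simp add: N_def cross_def algebra_simps)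
  have "(- (e6 \<otimes> e2)) * (- (e1 \<otimes> e3)) < (e6 \<otimes> e1) * (e2 \<otimes> e3)"
    using \<alpha>1 \<alpha>2 D by (intro mult_strict_mono') auto
  then have "0 < (e1 \<otimes> e2) * N" unfolding qN by (simp add: mult.commute)
  then have N: "0 < N" using q1 by (simp add: zero_less_mult_iff)
  have g1: "e3 \<otimes> e4 + e3 \<otimes> e5 = e1 \<otimes> e3 + e2 \<otimes> e3 - N"
    and g2: "e4 \<otimes> e6 + e5 \<otimes> e6 = e6 \<otimes> e1 + e6 \<otimes> e2 - N"
    unfolding e1 N_def by (simp_all add: cross_def algebra_simps)
  have g: "0 < e3 \<otimes> e4 + e3 \<otimes> e5" "0 < e4 \<otimes> e6 + e5 \<otimes> e6"
    using hex by (simp_all add: hexagon_edges_def cross_simps)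
  have "(e3 \<otimes> e4 + e3 \<otimes> e5) * (e4 \<otimes> e6 + e5 \<otimes> e6) \<le>
      (e1 \<otimes> e3 + e2 \<otimes> e3) * (e6 \<otimes> e1 + e6 \<otimes> e2)"
    using g g1 g2 N by (intro mult_mono) linarith+
  also have "\<dots> = (e1 \<otimes> e2) * N + (e6 \<otimes> e2) * (e1 \<otimes> e3 + e2 \<otimes> e3) + (e1 \<otimes> e3) * (e6 \<otimes> e1 + e6 \<otimes> e2)"
    unfolding qN by (simp add: algebra_simps)
  also have "\<dots> \<le> (e1 \<otimes> e2) * N"
    using D \<alpha>1 \<alpha>2 by (smt (verit) mult_nonpos_nonneg)
  finally have \<kappa>: "(e3 \<otimes> e4 + e3 \<otimes> e5) * (e4 \<otimes> e6 + e5 \<otimes> e6) \<le> (e1 \<otimes> e2) * N" .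
  define A1 where "A1 = e3 \<otimes> e4"
  define A2 where "A2 = e5 \<otimes> e6"
  define m where "m = e4 \<otimes> e5"
  define \<beta> where "\<beta> = e3 \<otimes> e5"
  define \<gamma> where "\<gamma> = e4 \<otimes> e6"
  have p: "0 < A1" "0 < A2" "0 < m" using hex by (simp_all add: A1_def A2_def m_def hexagon_edges_def)
  have mN: "m * N = \<beta> * \<gamma> - A1 * A2"
    using cross_relation[of e3 e4 e5 e6] by (simp add: m_def N_def \<beta>_def \<gamma>_def A1_def A2_def algebra_simps)
  have bg: "A1 * A2 < \<beta> * \<gamma>" using mN p N by (smt (verit) mult_pos_pos)
  have \<beta>\<gamma>: "0 < \<beta>" "0 < \<gamma>"
  proof -
    have "0 < A1 + \<beta>" "0 < \<gamma> + A2" using g by (simp_all add: A1_def A2_def \<beta>_def \<gamma>_def)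
    moreover have "\<not> (\<beta> \<le> 0 \<and> \<gamma> \<le> 0)"
    proof
      assume "\<beta> \<le> 0 \<and> \<gamma> \<le> 0"
      then have "(- \<beta>) * (- \<gamma>) \<le> A1 * A2" using \<open>0 < A1 + \<beta>\<close> \<open>0 < \<gamma> + A2\<close> by (intro mult_mono) auto
      then show False using bg by simp
    qed
    moreover have "0 < \<beta> * \<gamma>" using bg p by (smt (verit) mult_pos_pos)
    ultimately show "0 < \<beta>" "0 < \<gamma>" by (auto simp: zero_less_mult_iff)
  qed
  define X where "X = sqrt (\<beta> * \<gamma>)"
  define Y where "Y = sqrt (A1 * A2)"
  have X2: "X\<^sup>2 = \<beta> * \<gamma>" and Y2: "Y\<^sup>2 = A1 * A2" using \<beta>\<gamma> p by (simp_all add: X_def Y_def)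
  have XY: "0 < Y" "Y < X" using bg p by (simp_all add: X_def Y_def)
  have "(\<mu> * X)\<^sup>2 \<le> (m * Y)\<^sup>2"
  proof -
    have "\<mu> * \<beta> \<le> A1 * m" "\<mu> * \<gamma> \<le> m * A2"
      using large by (simp_all add: large_caps_def A1_def A2_def m_def \<beta>_def \<gamma>_def)
    then have "(\<mu> * \<beta>) * (\<mu> * \<gamma>) \<le> (A1 * m) * (m * A2)"
      using \<beta>\<gamma> p \<open>0 < \<mu>\<close> by (intro mult_mono[of "\<mu> * \<beta>" _ "\<mu> * \<gamma>"]) auto
    then show ?thesis by (simp add: power_mult_distrib X2 Y2) (simp add: power2_eq_square algebra_simps)
  qed
  then have \<mu>: "\<mu> * X \<le> m * Y" by (rule power2_le_imp_le) (use p XY in simp)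
  have sum: "2 * X * (X + Y) \<le> N * (e1 \<otimes> e2 + m)"
  proof -
    have "(X + Y)\<^sup>2 \<le> (A1 + \<beta>) * (\<gamma> + A2)"
    proof -
      have "2 * (X * Y) \<le> A1 * \<gamma> + \<beta> * A2"
      proof -
        have "(2 * (X * Y))\<^sup>2 = 4 * (A1 * \<gamma>) * (\<beta> * A2)"
          by (simp add: power_mult_distrib X2 Y2)
        also have "\<dots> \<le> (A1 * \<gamma> + \<beta> * A2)\<^sup>2"
          using zero_le_power2[of "A1 * \<gamma> - \<beta> * A2"] by (simp add: power2_eq_square algebra_simps)
        finally show ?thesis by (rule power2_le_imp_le) (use p \<beta>\<gamma> in auto)
      qed
      then show ?thesis using X2 Y2 by (simp add: power2_sum algebra_simps)
    qed
    also have "\<dots> \<le> (e1 \<otimes> e2) * N" using \<kappa> by (simp add: A1_def A2_def \<beta>_def \<gamma>_def)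
    finally have "(X + Y)\<^sup>2 + (X\<^sup>2 - Y\<^sup>2) \<le> (e1 \<otimes> e2) * N + m * N" using mN X2 Y2 by simp
    then show ?thesis by (simp add: power2_eq_square algebra_simps)
  qed
  have "N * (6 * \<mu> * X) \<le> 6 * (N * (m * Y))" using \<mu> N by simp
  also have "\<dots> = 6 * ((m * N) * Y)" by simp
  also have "\<dots> = 6 * ((X\<^sup>2 - Y\<^sup>2) * Y)" by (simp add: mN X2 Y2)
  also have "\<dots> = (X + Y) * (6 * ((X - Y) * Y))" by (simp add: power2_eq_square algebra_simps)
  also have "\<dots> \<le> (X + Y) * (2 * X\<^sup>2)"
  proof (rule mult_left_mono)
    have "4 * ((X - Y) * Y) \<le> X\<^sup>2" using zero_le_power2[of "X - 2 * Y"] by (simp add: power2_eq_square algebra_simps)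
    then show "6 * ((X - Y) * Y) \<le> 2 * X\<^sup>2" using zero_le_power2[of X] by linarith
  qed (use XY in simp)
  also have "\<dots> = (2 * X * (X + Y)) * X" by (simp add: power2_eq_square)
  also have "\<dots> \<le> (N * (e1 \<otimes> e2 + m)) * X" using sum XY by (intro mult_right_mono) auto
  finally have "(N * X) * (6 * \<mu>) \<le> (N * X) * (e1 \<otimes> e2 + m)" by (simp add: algebra_simps)
  then have "6 * \<mu> \<le> e1 \<otimes> e2 + m" using N XY by (simp add: mult_le_cancel_left)
  also have "\<dots> \<le> hexagon_area2 e1 e2 e3 e4 e5 e6"
  proof -
    have "hexagon_area2 e1 e2 e3 e4 e5 e6 = e1 \<otimes> e2 + m + e3 \<otimes> (e4 + e5) + e6 \<otimes> (e1 + e2)"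
      unfolding hexagon_area2_def m_def e1 by (simp add: cross_def algebra_simps)
    then show ?thesis using hex by (simp add: hexagon_edges_def)
  qed
  finally show ?thesis .
qed

text \<open>
  Otherwise the exterior angles at the ends of \<open>e1\<close> and of \<open>e4\<close> would add up to at least \<open>2 \<pi>\<close>, although this
  is the sum of all six. In terms of cross products:
  seen from the chord \<open>g\<close>, the slopes of \<open>e2\<close>, \<open>e3\<close>, \<open>e5\<close>, \<open>e6\<close> would form a cycle of inequalities.
\<close>
lemma opposite_edges_not_both_capless:
  assumes hex: "hexagon_edges e1 e2 e3 e4 e5 e6"
  shows "0 < e6 \<otimes> e2 \<or> 0 < e3 \<otimes> e5"
proof (rule ccontr)
  assume neg: "\<not> ?thesis"
  have e1: "e1 = - e2 - e3 - e4 - e5 - e6"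
    using hex by (simp add: hexagon_edges_def algebra_simps eq_neg_iff_add_eq_0)
  define g where "g = e3 + e4 + e5"
  have "e2 \<otimes> g = (e6 + e1) \<otimes> e2" "e6 \<otimes> g = - (e6 \<otimes> (e1 + e2))" "e3 \<otimes> g = e3 \<otimes> (e4 + e5)"
      "e5 \<otimes> g = - ((e3 + e4) \<otimes> e5)"
    unfolding g_def e1 by (simp_all add: cross_def algebra_simps)
  then have g: "0 < e2 \<otimes> g" "e6 \<otimes> g < 0" "0 < e3 \<otimes> g" "e5 \<otimes> g < 0"
    using hex by (simp_all add: hexagon_edges_def)
  have q: "0 < e5 \<otimes> e6" "0 < e2 \<otimes> e3" using hex by (simp_all add: hexagon_edges_def)
  have "(e2 \<otimes> e3) * (e5 \<otimes> g) + (e3 \<otimes> e5) * (e2 \<otimes> g) + (e5 \<otimes> e2) * (e3 \<otimes> g) = 0"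
    by (simp add: cross_def algebra_simps)
  moreover have "(e2 \<otimes> e3) * (e5 \<otimes> g) < 0" "(e3 \<otimes> e5) * (e2 \<otimes> g) \<le> 0"
    using q g neg by (simp_all add: mult_pos_neg mult_nonpos_nonneg)
  ultimately have "0 < (e5 \<otimes> e2) * (e3 \<otimes> g)" by linarith
  then have "0 < e5 \<otimes> e2" using g by (simp add: zero_less_mult_iff)
  have "(e5 \<otimes> e6) * (e2 \<otimes> g) + (e6 \<otimes> e2) * (e5 \<otimes> g) + (- (e5 \<otimes> e2)) * (e6 \<otimes> g) = 0"
    by (simp add: cross_def algebra_simps)
  moreover have "0 < (e5 \<otimes> e6) * (e2 \<otimes> g)" "0 \<le> (e6 \<otimes> e2) * (e5 \<otimes> g)" "0 < (- (e5 \<otimes> e2)) * (e6 \<otimes> g)"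
    using q g neg \<open>0 < e5 \<otimes> e2\<close> by (simp_all add: mult_nonpos_nonpos mult_pos_neg)
  ultimately show False by linarith
qed

lemma area2_ge_of_large_caps:
  assumes hex: "hexagon_edges e1 e2 e3 e4 e5 e6" and large: "large_caps \<mu> e1 e2 e3 e4 e5 e6" and "0 < \<mu>"
  shows "6 * \<mu> \<le> hexagon_area2 e1 e2 e3 e4 e5 e6"
proof -
  note h2 = hexagon_edges_rotate[OF hex] note h3 = hexagon_edges_rotate[OF h2] 
  note h4 = hexagon_edges_rotate[OF h3] note h5 = hexagon_edges_rotate[OF h4]
  note h6 = hexagon_edges_rotate[OF h5]
  note t2 = large_caps_rotate[OF large] note t3 = large_caps_rotate[OF t2] 
  note t4 = large_caps_rotate[OF t3] note t5 = large_caps_rotate[OF t4]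
  note t6 = large_caps_rotate[OF t5]
  have r: "hexagon_area2 e2 e3 e4 e5 e6 e1 = hexagon_area2 e1 e2 e3 e4 e5 e6"
    "hexagon_area2 e3 e4 e5 e6 e1 e2 = hexagon_area2 e1 e2 e3 e4 e5 e6"
    "hexagon_area2 e4 e5 e6 e1 e2 e3 = hexagon_area2 e1 e2 e3 e4 e5 e6"
    "hexagon_area2 e5 e6 e1 e2 e3 e4 = hexagon_area2 e1 e2 e3 e4 e5 e6"
    "hexagon_area2 e6 e1 e2 e3 e4 e5 = hexagon_area2 e1 e2 e3 e4 e5 e6"
    using hexagon_area2_rotate[OF hex] hexagon_area2_rotate[OF h2] hexagon_area2_rotate[OF h3]
      hexagon_area2_rotate[OF h4] hexagon_area2_rotate[OF h5] by simp_all
  note opp = opposite_edges_not_both_capless[OF hex] opposite_edges_not_both_capless[OF h2]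
    opposite_edges_not_both_capless[OF h3]
  consider "0 < e1 \<otimes> e3" "0 < e3 \<otimes> e5" "0 < e5 \<otimes> e1" | "0 < e2 \<otimes> e4" "0 < e4 \<otimes> e6" "0 < e6 \<otimes> e2"
    | "e6 \<otimes> e2 \<le> 0" "e1 \<otimes> e3 \<le> 0" | "e1 \<otimes> e3 \<le> 0" "e2 \<otimes> e4 \<le> 0" | "e2 \<otimes> e4 \<le> 0" "e3 \<otimes> e5 \<le> 0"
    | "e3 \<otimes> e5 \<le> 0" "e4 \<otimes> e6 \<le> 0" | "e4 \<otimes> e6 \<le> 0" "e5 \<otimes> e1 \<le> 0" | "e5 \<otimes> e1 \<le> 0" "e6 \<otimes> e2 \<le> 0"
    using opp by linarith
  then show ?thesis
  proof cases
    case 1 then show ?thesis using area2_ge_between_three_lines[OF hex large \<open>0 < \<mu>\<close>] by simp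
  next
    case 2 then show ?thesis using area2_ge_between_three_lines[OF h2 t2 \<open>0 < \<mu>\<close>] r by simp
  next
    case 3 then show ?thesis using area2_ge_two_capless_edges[OF hex large \<open>0 < \<mu>\<close>] by simp
  next
    case 4 then show ?thesis using area2_ge_two_capless_edges[OF h2 t2 \<open>0 < \<mu>\<close>] r by simp
  next
    case 5 then show ?thesis using area2_ge_two_capless_edges[OF h3 t3 \<open>0 < \<mu>\<close>] r by simp
  next
    case 6 then show ?thesis using area2_ge_two_capless_edges[OF h4 t4 \<open>0 < \<mu>\<close>] r by simp
  next
    case 7 then show ?thesis using area2_ge_two_capless_edges[OF h5 t5 \<open>0 < \<mu>\<close>] r by simp
  next
    case 8 then show ?thesis using area2_ge_two_capless_edges[OF h6 t6 \<open>0 < \<mu>\<close>] r by simp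
  qed
qed

text \<open>
  Apply the lower bound for the area with the doubled area of the smallest existing cap as \<open>\<mu>\<close>. There is a cap
  at all, because one of two opposite edges has one.
\<close>
lemma ex_small_cap:
  assumes hex: "hexagon_edges e1 e2 e3 e4 e5 e6"
  shows "\<exists>(a, b, c) \<in> {(e6, e1, e2), (e1, e2, e3), (e2, e3, e4), (e3, e4, e5), (e4, e5, e6), (e5, e6, e1)}.
    0 < a \<otimes> c \<and> 6 * ((a \<otimes> b) * (b \<otimes> c)) \<le> hexagon_area2 e1 e2 e3 e4 e5 e6 * (a \<otimes> c)"
proof -
  define S where "S = {(e6, e1, e2), (e1, e2, e3), (e2, e3, e4), (e3, e4, e5), (e4, e5, e6), (e5, e6, e1)}"
  define S' where "S' = {(a, b, c) \<in> S. 0 < a \<otimes> c}"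
  define cap where "cap = (\<lambda>(a, b, c). (a \<otimes> b) * (b \<otimes> c) / (a \<otimes> c))"
  have pos: "0 < a \<otimes> b" "0 < b \<otimes> c" if "(a, b, c) \<in> S" for a b c
    using that hex by (auto simp: S_def hexagon_edges_def)
  have "finite S'" by (rule finite_subset[of _ S]) (auto simp: S'_def S_def)
  moreover have "S' \<noteq> {}"
    using opposite_edges_not_both_capless[OF hex] by (auto simp: S'_def S_def)
  ultimately obtain x where x: "x \<in> S'" and min: "\<And>y. y \<in> S' \<Longrightarrow> cap x \<le> cap y"
    using arg_min_if_finite[of S' cap] by (metis linorder_not_le)
  obtain a b c where [simp]: "x = (a, b, c)" by (cases x) auto
  have abc: "(a, b, c) \<in> S" "0 < a \<otimes> c" using x by (auto simp: S'_def)
  then have \<mu>: "0 < cap x" using pos by (simp add: cap_def)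
  have "cap x * (a' \<otimes> c') \<le> (a' \<otimes> b') * (b' \<otimes> c')" if "(a', b', c') \<in> S" for a' b' c'
  proof (cases "0 < a' \<otimes> c'")
    case True
    then have "cap x \<le> (a' \<otimes> b') * (b' \<otimes> c') / (a' \<otimes> c')"
      using min[of "(a', b', c')"] that by (auto simp: S'_def cap_def)
    then show ?thesis using True by (simp add: pos_le_divide_eq)
  next
    case False
    then have "cap x * (a' \<otimes> c') \<le> 0" using \<mu> by (simp add: mult_nonneg_nonpos)
    then show ?thesis using pos[OF that] by (smt (verit) mult_pos_pos)
  qed
  then have "large_caps (cap x) e1 e2 e3 e4 e5 e6" by (simp add: large_caps_def S_def)
  then have "6 * cap x \<le> hexagon_area2 e1 e2 e3 e4 e5 e6" by (rule area2_ge_of_large_caps[OF hex _ \<mu>])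
  then have "6 * ((a \<otimes> b) * (b \<otimes> c)) \<le> hexagon_area2 e1 e2 e3 e4 e5 e6 * (a \<otimes> c)"
    using abc by (simp add: cap_def divide_le_eq)
  then show ?thesis using abc unfolding S_def by blast
qed

section \<open>Convex polygons given by their vertex lists\<close>

definition orient :: "real^2 \<Rightarrow> real^2 \<Rightarrow> real^2 \<Rightarrow> real" where
  "orient a b c = (b - a) \<otimes> (c - a)"

lemma orient_rotate: "orient b c a = orient a b c"
  by (simp add: orient_def cross_def algebra_simps)

lemma orient_swap: "orient b a c = - orient a b c"
  by (simp add: orient_def cross_def algebra_simps)

lemma orient_same: "orient a a b = 0" "orient a b a = 0" "orient a b b = 0"
  by (simp_all add: orient_def cross_def)

lemma orient_affine_combination:
  assumes "u + v = 1"
  shows "orient a b (u *\<^sub>R x + v *\<^sub>R y) = u * orient a b x + v * orient a b y"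
proof -
  have v: "v = 1 - u" using assms by simp
  show ?thesis unfolding v by (simp add: orient_def cross_def algebra_simps)
qed

text \<open>
  Cross products with a fixed vector are inner products with its quarter turn; this gives access to the
  facts about half-planes, which are stated with inner products.
\<close>
definition quarter_turn :: "real^2 \<Rightarrow> real^2" where
  "quarter_turn v = vector [- v $ 2, v $ 1]"

lemma inner_quarter_turn: "quarter_turn v \<bullet> w = v \<otimes> w"
  by (simp add: quarter_turn_def cross_def inner_vec_def sum_2)

lemma orient_eq_inner: "orient a b c = quarter_turn (b - a) \<bullet> c - quarter_turn (b - a) \<bullet> a"
  by (simp add: inner_quarter_turn orient_def cross_simps)

lemma hull_subset_left_half_plane:
  assumes "x \<in> convex hull S" and "\<forall>s\<in>S. 0 \<le> orient a b s"
  shows "0 \<le> orient a b x"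
proof -
  have "{w. 0 \<le> orient a b w} = {w. quarter_turn (b - a) \<bullet> w \<ge> quarter_turn (b - a) \<bullet> a}"
    by (simp add: orient_eq_inner)
  then have "convex {w. 0 \<le> orient a b w}" by (simp add: convex_halfspace_ge)
  then have "convex hull S \<subseteq> {w. 0 \<le> orient a b w}" using assms(2) by (intro hull_minimal) auto
  then show ?thesis using assms(1) by auto
qed

text \<open>
  Requiring all triples to be positively oriented, not only consecutive ones, excludes star polygons
  and makes the notion stable under removing vertices.
\<close>
definition ccw_polygon :: "(real^2) list \<Rightarrow> bool" where
  "ccw_polygon vs \<longleftrightarrow> (\<forall>k<length vs. \<forall>j<k. \<forall>i<j. 0 < orient (vs ! i) (vs ! j) (vs ! k))"

lemma ccw_polygonD:
  "ccw_polygon vs \<Longrightarrow> i < j \<Longrightarrow> j < k \<Longrightarrow> k < length vs \<Longrightarrow> 0 < orient (vs ! i) (vs ! j) (vs ! k)"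
  by (simp add: ccw_polygon_def)

lemma ccw_polygon_butlast:
  assumes "ccw_polygon (vs @ [x])" shows "ccw_polygon vs"
  unfolding ccw_polygon_def
proof (intro allI impI)
  fix k j i assume "k < length vs" "j < k" "i < j"
  then show "0 < orient (vs ! i) (vs ! j) (vs ! k)"
    using ccw_polygonD[OF assms, of i j k] by (simp add: nth_append)
qed

lemma ccw_polygon_rotate1:
  assumes "ccw_polygon vs" shows "ccw_polygon (rotate1 vs)"
proof (cases vs)
  case (Cons x xs)
  show ?thesis unfolding ccw_polygon_def
  proof (intro allI impI)
    fix i j k assume k: "k < length (rotate1 vs)" and "j < k" "i < j"
    then have ij: "rotate1 vs ! i = vs ! Suc i" "rotate1 vs ! j = vs ! Suc j"
      using Cons by (auto simp: nth_append)
    show "0 < orient (rotate1 vs ! i) (rotate1 vs ! j) (rotate1 vs ! k)"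
    proof (cases "k < length xs")
      case True
      then have "rotate1 vs ! k = vs ! Suc k" using Cons by (auto simp: nth_append)
      then show ?thesis using ccw_polygonD[OF assms, of "Suc i" "Suc j" "Suc k"] ij k \<open>j < k\<close> \<open>i < j\<close> True Cons by simp
    next
      case False
      then have "rotate1 vs ! k = vs ! 0" using Cons k by (auto simp: nth_append)
      then show ?thesis using ccw_polygonD[OF assms, of 0 "Suc i" "Suc j"] ij k \<open>j < k\<close> \<open>i < j\<close> False Cons
        by (simp add: orient_rotate)
    qed
  qed
qed (use assms in simp)

lemma ccw_polygon_rotate: "ccw_polygon vs \<Longrightarrow> ccw_polygon (rotate n vs)"
  by (induction n) (simp_all add: ccw_polygon_rotate1)

lemma ccw_polygon_distinct:
  assumes "ccw_polygon vs" "3 \<le> length vs"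
  shows "distinct vs"
proof -
  have "vs ! i \<noteq> vs ! j" if "i < j" "j < length vs" for i j
  proof
    assume eq: "vs ! i = vs ! j"
    have "\<exists>k\<in>{0, 1, 2::nat}. k \<noteq> i \<and> k \<noteq> j" by auto
    then obtain k where k: "k \<in> {0, 1, 2::nat}" "k \<noteq> i" "k \<noteq> j" by blast
    have "k < length vs" using k(1) assms(2) by auto
    from k consider "k < i" | "i < k" "k < j" | "j < k" by linarith
    then show False
      using ccw_polygonD[OF assms(1), of k i j] ccw_polygonD[OF assms(1), of i k j]
        ccw_polygonD[OF assms(1), of i j k] that eq \<open>k < length vs\<close>
      by cases (auto simp: orient_same)
  qed
  then show ?thesis unfolding distinct_conv_nth by (metis linorder_neqE_nat)
qed

text \<open>
  All other vertices lie strictly to the left of the line through \<open>a\<close> and \<open>b\<close>, which hence supports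
  the convex hull exactly in the segment from \<open>a\<close> to \<open>b\<close>.
\<close>
lemma ccw_polygon_first_edge:
  assumes "ccw_polygon (a # b # vs)" "vs \<noteq> []"
  shows "closed_segment a b edge_of convex hull (set (a # b # vs))"
proof -
  let ?P = "convex hull (set (a # b # vs))"
  let ?n = "quarter_turn (b - a)"
  let ?F = "?P \<inter> {x. ?n \<bullet> x = ?n \<bullet> a}"
  have pos: "0 < orient a b s" if "s \<in> set vs" for s
  proof -
    from that obtain k where "k < length vs" "s = vs ! k" by (auto simp: in_set_conv_nth)
    then show ?thesis using ccw_polygonD[OF assms(1), of 0 1 "Suc (Suc k)"] by simp
  qed
  have ab: "a \<noteq> b"
    using pos[of "hd vs"] assms(2) by (auto simp: orient_same)
  have ge: "0 \<le> orient a b x" if "x \<in> ?P" for x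
    by (rule hull_subset_left_half_plane[OF that]) (use pos in \<open>auto simp: orient_same less_imp_le\<close>)
  have face: "?F face_of ?P"
    using ge by (intro face_of_Int_supporting_hyperplane_ge) (auto simp: orient_eq_inner)
  have "compact (set (a # b # vs))" by (rule finite_imp_compact) simp
  from face_of_convex_hull_subset[OF this face]
  obtain S where S: "S \<subseteq> set (a # b # vs)" "?F = convex hull S" .
  have "S \<subseteq> {a, b}"
  proof
    fix s assume "s \<in> S"
    then have "s \<in> ?F" using S(2) by (simp add: hull_inc)
    then have "orient a b s = 0" by (simp add: orient_eq_inner)
    then show "s \<in> {a, b}" using \<open>s \<in> S\<close> S(1) pos by force
  qed
  then have "?F \<subseteq> closed_segment a b" unfolding S(2) segment_convex_hull by (rule hull_mono)
  moreover have "closed_segment a b \<subseteq> ?F"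
  proof -
    have "orient a b a = 0" "orient a b b = 0" by (simp_all add: orient_same)
    then have "{a, b} \<subseteq> ?F" by (auto simp: hull_inc orient_eq_inner)
    then show ?thesis unfolding segment_convex_hull
      using face by (intro hull_minimal) (auto dest: face_of_imp_convex)
  qed
  ultimately have F: "closed_segment a b = ?F" by blast
  have "aff_dim (closed_segment a b) = 1"
    using ab by (simp add: segment_convex_hull aff_dim_convex_hull aff_dim_2)
  then show ?thesis using face F by (simp add: edge_of_def)
qed

lemma ccw_polygon_edge:
  assumes "ccw_polygon vs" "3 \<le> length vs" "i < length vs"
  shows "closed_segment (vs ! i) (vs ! (Suc i mod length vs)) edge_of convex hull (set vs)"
proof -
  let ?r = "rotate i vs"
  have nth: "?r ! 0 = vs ! i" "?r ! 1 = vs ! (Suc i mod length vs)"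
    using assms(2,3) nth_rotate[of 0 vs i] nth_rotate[of 1 vs i]
    by (simp_all del: length_greater_0_conv)
  obtain a b ws where r: "?r = a # b # ws" "ws \<noteq> []"
  proof (cases ?r)
    case Nil then show ?thesis using assms(2) by simp
  next
    case (Cons a l)
    then have "length (a # l) = length vs" by (metis length_rotate)
    then obtain b ws where "l = b # ws" "ws \<noteq> []" using assms(2)
      by (cases l; cases "tl l") auto
    then show ?thesis using that Cons by blast
  qed
  have "ccw_polygon (a # b # ws)" using ccw_polygon_rotate[OF assms(1), of i] r by simp
  from ccw_polygon_first_edge[OF this r(2)]
  have "closed_segment (?r ! 0) (?r ! 1) edge_of convex hull (set ?r)" unfolding r(1) by simp
  then show ?thesis unfolding nth set_rotate .
qed

lemma ccw_polygon_vertices: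
  assumes "ccw_polygon vs" "3 \<le> length vs"
  shows "vertices (convex hull (set vs)) = set vs"
proof
  show "vertices (convex hull (set vs)) \<subseteq> set vs"
    unfolding vertices_def by (rule extreme_points_of_convex_hull)
  show "set vs \<subseteq> vertices (convex hull (set vs))"
  proof
    fix v assume "v \<in> set vs"
    then obtain i where i: "i < length vs" "v = vs ! i" by (auto simp: in_set_conv_nth)
    from ccw_polygon_edge[OF assms i(1)]
    have "closed_segment v (vs ! (Suc i mod length vs)) face_of convex hull (set vs)"
      by (simp add: edge_of_def i(2))
    from extreme_point_of_face[OF this, of v] show "v \<in> vertices (convex hull (set vs))"
      by (simp add: vertices_def extreme_point_of_segment)
  qed
qed

lemma ccw_polygon_cyclic_vertices:
  assumes "ccw_polygon vs" "3 \<le> length vs"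
  shows "cyclic_vertices (convex hull (set vs)) vs"
  unfolding cyclic_vertices_def
  using assms ccw_polygon_distinct ccw_polygon_vertices ccw_polygon_edge by auto

lemma area_triangle: "area (convex hull {a, b, c}) = \<bar>orient a b c\<bar> / 2"
proof -
  have "area (convex hull {a, b, c}) = measure lborel (convex hull {a, b, c})"
    by (intro measure_completion) (simp add: finite_imp_compact_convex_hull compact_imp_closed)
  moreover have "(c $ 1 - a $ 1) * (b $ 2 - a $ 2) - (b $ 1 - a $ 1) * (c $ 2 - a $ 2) = - orient a b c"
    by (simp add: orient_def cross_def)
  ultimately show ?thesis by (simp add: content_triangle)
qed

text \<open>
  The assumptions say that \<open>S\<close> lies on one side of the line \<open>ab\<close>, the new point \<open>x\<close> on the other side,
  and that \<open>S\<close> is seen from \<open>x\<close> inside the angle between \<open>a\<close> and \<open>b\<close>. A segment from \<open>x\<close> to the hull of \<open>S\<close> crosses the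
  line \<open>ab\<close> therefore between \<open>a\<close> and \<open>b\<close>, and the crossing point splits it into a part in the triangle and a
  part in the old hull.
\<close>
lemma hull_insert_ear:
  assumes ab: "a \<in> S" "b \<in> S" and x: "0 < orient a b x"
    and S: "\<And>s. s \<in> S \<Longrightarrow> 0 \<le> orient b a s" "\<And>s. s \<in> S \<Longrightarrow> 0 \<le> orient b x s"
      "\<And>s. s \<in> S \<Longrightarrow> 0 \<le> orient x a s"
  shows "convex hull (insert x S) = convex hull S \<union> convex hull {a, b, x}"
proof
  show "convex hull S \<union> convex hull {a, b, x} \<subseteq> convex hull (insert x S)"
    using ab by (intro Un_least hull_mono) auto
  show "convex hull (insert x S) \<subseteq> convex hull S \<union> convex hull {a, b, x}"
  proof
    fix z assume z: "z \<in> convex hull (insert x S)"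
    obtain u v y where uv: "0 \<le> u" "0 \<le> v" "u + v = 1" and y: "y \<in> convex hull S"
      and z: "z = u *\<^sub>R x + v *\<^sub>R y"
    proof -
      have ne: "S \<noteq> {}" using ab(1) by blast
      from z have "\<exists>u\<ge>0. \<exists>v\<ge>0. \<exists>y. u + v = 1 \<and> y \<in> convex hull S \<and> z = u *\<^sub>R x + v *\<^sub>R y"
        unfolding convex_hull_insert[OF ne] mem_Collect_eq .
      then show ?thesis by (elim exE conjE) (rule that)
    qed
    define f where "f = orient b a"
    have fy: "0 \<le> f y" unfolding f_def using S(1) by (intro hull_subset_left_half_plane[OF y]) blast
    have fx: "f x < 0" using x by (simp add: f_def orient_swap[of b a x])
    define \<tau> where "\<tau> = f y / (f y - f x)"
    have \<tau>: "0 \<le> \<tau>" "\<tau> < 1" using fx fy by (auto simp: \<tau>_def divide_simps)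
    define c where "c = \<tau> *\<^sub>R x + (1 - \<tau>) *\<^sub>R y"
    have "f c = \<tau> * f x + (1 - \<tau>) * f y" unfolding f_def c_def by (rule orient_affine_combination) simp
    also have "\<dots> = 0" using fx fy by (simp add: \<tau>_def field_simps)
    finally have fc: "orient b a c = 0" by (simp add: f_def)
    have c: "c \<in> convex hull (insert x S)"
      unfolding c_def using y \<tau> hull_mono[of S "insert x S" convex]
      by (intro convexD[OF convex_convex_hull]) (auto simp: hull_inc)
    have cb: "0 \<le> orient b x c" by (rule hull_subset_left_half_plane[OF c]) (use S in \<open>auto simp: orient_same\<close>)
    have ca: "0 \<le> orient x a c" by (rule hull_subset_left_half_plane[OF c]) (use S in \<open>auto simp: orient_same\<close>)
    define \<alpha> where "\<alpha> = ((c - b) \<otimes> (x - b)) / ((a - b) \<otimes> (x - b))"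
    have neg: "(a - b) \<otimes> (x - b) < 0" using fx by (simp add: f_def orient_def)
    have "c - b = \<alpha> *\<^sub>R (a - b) + (((a - b) \<otimes> (c - b)) / ((a - b) \<otimes> (x - b))) *\<^sub>R (x - b)"
      unfolding \<alpha>_def using neg by (intro cross_coordinates) simp
    then have "c - b = \<alpha> *\<^sub>R (a - b)" using fc by (simp add: orient_def)
    then have c_eq: "c = \<alpha> *\<^sub>R a + (1 - \<alpha>) *\<^sub>R b" by (simp add: algebra_simps)
    have "(c - b) \<otimes> (x - b) \<le> 0" using cb by (simp add: orient_def cross_swap[of "x - b"])
    then have \<alpha>0: "0 \<le> \<alpha>" using neg by (simp add: \<alpha>_def divide_nonpos_neg)
    have "orient x a c = \<alpha> * orient x a a + (1 - \<alpha>) * orient x a b"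
      unfolding c_eq by (rule orient_affine_combination) simp
    then have "0 \<le> (1 - \<alpha>) * orient a b x" using ca orient_rotate[of a b x] by (simp add: orient_same)
    then have \<alpha>1: "\<alpha> \<le> 1" using x by (simp add: zero_le_mult_iff)
    have cS: "c \<in> convex hull S" and cT: "c \<in> convex hull {a, b, x}"
      unfolding c_eq using ab \<alpha>0 \<alpha>1 by (auto intro!: convexD[OF convex_convex_hull] simp: hull_inc)
    show "z \<in> convex hull S \<union> convex hull {a, b, x}"
    proof (cases "u \<le> \<tau>")
      case True
      show ?thesis
      proof (cases "\<tau> = 0")
        case True
        then have "z = y" using z uv \<open>u \<le> \<tau>\<close> by simp
        then show ?thesis using y by simp
      next
        case False
        define k where "k = u / \<tau>"
        have k: "0 \<le> k" "k \<le> 1" "k * \<tau> = u" using False True \<tau> uv by (auto simp: k_def)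
        have "z = k *\<^sub>R c + (1 - k) *\<^sub>R y"
        proof -
          have "v = k * (1 - \<tau>) + (1 - k)" using k(3) uv(3) by (simp add: algebra_simps)
          then show ?thesis unfolding z c_def using k(3) by (simp add: scaleR_add_right scaleR_add_left)
        qed
        then have "z \<in> convex hull S" using k cS y by (auto intro!: convexD[OF convex_convex_hull])
        then show ?thesis by simp
      qed
    next
      case False
      define k where "k = v / (1 - \<tau>)"
      have k: "0 \<le> k" "k \<le> 1" "k * (1 - \<tau>) = v" using False \<tau> uv by (auto simp: k_def)
      have "z = k *\<^sub>R c + (1 - k) *\<^sub>R x"
      proof -
        have "u = k * \<tau> + (1 - k)" using k(3) uv(3) by (simp add: algebra_simps)
        then show ?thesis unfolding z c_def using k(3) by (simp add: scaleR_add_right scaleR_add_left)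
      qed
      moreover have "x \<in> convex hull {a, b, x}" by (simp add: hull_inc)
      ultimately have "z \<in> convex hull {a, b, x}" using k cT by (auto intro!: convexD[OF convex_convex_hull])
      then show ?thesis by simp
    qed
  qed
qed

lemma area_hull_insert_ear:
  assumes "finite S" and ab: "a \<in> S" "b \<in> S" and x: "0 < orient a b x"
    and S: "\<And>s. s \<in> S \<Longrightarrow> 0 \<le> orient b a s" "\<And>s. s \<in> S \<Longrightarrow> 0 \<le> orient b x s"
      "\<And>s. s \<in> S \<Longrightarrow> 0 \<le> orient x a s"
  shows "area (convex hull (insert x S)) = area (convex hull S) + orient a b x / 2"
proof -
  have m: "convex hull S \<in> lmeasurable" "convex hull {a, b, x} \<in> lmeasurable"
    using assms(1) by (auto intro!: lmeasurable_compact finite_imp_compact_convex_hull)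
  have "convex hull S \<inter> convex hull {a, b, x} \<subseteq> {w. quarter_turn (b - a) \<bullet> w = quarter_turn (b - a) \<bullet> a}"
  proof
    fix w assume w: "w \<in> convex hull S \<inter> convex hull {a, b, x}"
    then have "0 \<le> orient b a w" using S(1) by (intro hull_subset_left_half_plane[of w S]) auto
    moreover have "0 \<le> orient a b w"
      using w x by (intro hull_subset_left_half_plane[of w "{a, b, x}"]) (auto simp: orient_same)
    ultimately show "w \<in> {w. quarter_turn (b - a) \<bullet> w = quarter_turn (b - a) \<bullet> a}"
      using orient_swap[of b a w] by (simp add: orient_eq_inner[of a b])
  qed
  moreover have "quarter_turn (b - a) \<noteq> 0"
    using x by (metis inner_zero_left inner_quarter_turn orient_def less_irrefl)
  ultimately have "negligible (convex hull S \<inter> convex hull {a, b, x})"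
    using negligible_hyperplane[of "quarter_turn (b - a)" "quarter_turn (b - a) \<bullet> a"] negligible_subset by blast
  then have "area (convex hull S \<union> convex hull {a, b, x}) = area (convex hull S) + area (convex hull {a, b, x})"
    using m by (simp add: measure_Un3 negligible_imp_measure0)
  then show ?thesis
    using hull_insert_ear[OF ab x S] x by (simp add: area_triangle)
qed

lemma area_ccw_polygon_snoc:
  assumes "ccw_polygon (vs @ [x])" "2 \<le> length vs"
  shows "area (convex hull (set (vs @ [x]))) = area (convex hull (set vs)) + orient (hd vs) (last vs) x / 2"
proof -
  let ?n = "length vs"
  have "vs \<noteq> []" using assms(2) by auto
  then have hd: "hd vs = vs ! 0" and last: "last vs = vs ! (?n - 1)"
    by (simp_all add: hd_conv_nth last_conv_nth)
  have D: "0 < orient (vs ! i) (vs ! j) x" if "i < j" "j < ?n" for i j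
    using ccw_polygonD[OF assms(1), of i j ?n] that by (simp add: nth_append)
  have x0: "0 < orient (hd vs) (last vs) x"
    unfolding hd last by (rule D) (use assms(2) in auto)
  have D': "0 < orient (vs ! i) (vs ! j) (vs ! k)" if "i < j" "j < k" "k < ?n" for i j k
    using ccw_polygonD[OF ccw_polygon_butlast[OF assms(1)]] that by simp
  have "area (convex hull (insert x (set vs))) = area (convex hull (set vs)) + orient (hd vs) (last vs) x / 2"
  proof (rule area_hull_insert_ear)
    fix s assume "s \<in> set vs"
    then obtain k where k: "k < ?n" "s = vs ! k" by (auto simp: in_set_conv_nth)
    show "0 \<le> orient (last vs) (hd vs) s"
    proof (cases "k = 0 \<or> k = ?n - 1")
      case False
      then have "0 < orient (hd vs) s (last vs)" unfolding hd last k(2) using k by (intro D') auto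
      then show ?thesis by (simp add: orient_rotate)
    qed (auto simp: hd last k orient_same)
    show "0 \<le> orient (last vs) x s"
      using D[of k "?n - 1"] k orient_rotate[of "last vs" x s]
      by (cases "k = ?n - 1") (auto simp: last orient_same less_imp_le)
    show "0 \<le> orient x (hd vs) s"
      using D[of 0 k] k orient_rotate[of "hd vs" s x]
      by (cases "k = 0") (auto simp: hd orient_same less_imp_le)
  qed (use x0 \<open>vs \<noteq> []\<close> in auto)
  then show ?thesis by simp
qed

text \<open>
  Choose a point \<open>p\<close> of \<open>S\<close> and separate it from the others by a line with normal \<open>n\<close>. The others then
  lie in an open half-plane at \<open>p\<close> and can be sorted by their slopes; no two slopes agree, as the nearer of two
  points on a ray from \<open>p\<close> would not be extreme. If three points in this order turned the
  wrong way, then the middle one would lie in the triangle formed by \<open>p\<close> and the other two.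
\<close>
lemma convex_position_ccw_polygon:
  assumes "finite S" "S \<noteq> {}" and ext: "\<And>s. s \<in> S \<Longrightarrow> s \<notin> convex hull (S - {s})"
  shows "\<exists>vs. set vs = S \<and> ccw_polygon vs"
proof -
  obtain p where p: "p \<in> S" using assms(2) by blast
  let ?S = "S - {p}"
  obtain n \<beta> where n: "n \<bullet> p < \<beta>" "\<forall>x\<in>convex hull ?S. \<beta> < n \<bullet> x"
    using separating_hyperplane_closed_point[of "convex hull ?S" p] ext[OF p] assms(1)
    by (auto simp: finite_imp_compact_convex_hull compact_imp_closed)
  have pos: "0 < n \<bullet> (x - p)" if "x \<in> ?S" for x
    using n(1) bspec[OF n(2), of x] that by (simp add: inner_diff_right hull_inc)
  define slope where "slope x = (n \<otimes> (x - p)) / (n \<bullet> (x - p))" for x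
  have n0: "n \<bullet> n > 0 \<or> ?S = {}" using pos by fastforce
  have orient_slope: "(n \<bullet> n) * orient p x y = (n \<bullet> (x - p)) * (n \<bullet> (y - p)) * (slope y - slope x)"
    if "x \<in> ?S" "y \<in> ?S" for x y
  proof -
    have "(n \<bullet> n) * orient p x y = (n \<bullet> (x - p)) * (n \<otimes> (y - p)) - (n \<bullet> (y - p)) * (n \<otimes> (x - p))"
      by (simp add: orient_def cross_def inner_vec_def sum_2 algebra_simps)
    moreover have "n \<otimes> (x - p) = slope x * (n \<bullet> (x - p))" "n \<otimes> (y - p) = slope y * (n \<bullet> (y - p))"
      using pos[OF that(1)] pos[OF that(2)] by (simp_all add: slope_def)
    ultimately show ?thesis by (simp add: algebra_simps)
  qed
  have orient_pos: "0 < orient p x y" if "x \<in> ?S" "y \<in> ?S" "slope x < slope y" for x y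
  proof -
    have "0 < (n \<bullet> n) * orient p x y" unfolding orient_slope[OF that(1,2)]
      using pos[OF that(1)] pos[OF that(2)] that(3) by simp
    moreover have "0 < n \<bullet> n" using n0 that(1) by auto
    ultimately show ?thesis by (rule zero_less_mult_pos)
  qed
  have inj: "inj_on slope ?S"
  proof (rule inj_onI, rule ccontr)
    have *: False if "x \<in> ?S" "y \<in> ?S" "x \<noteq> y" "orient p x y = 0" "n \<bullet> (x - p) \<le> n \<bullet> (y - p)" for x y
    proof -
      define k where "k = (n \<bullet> (x - p)) / (n \<bullet> (y - p))"
      have k: "0 \<le> k" "k \<le> 1" using that pos by (auto simp: k_def less_imp_le)
      have "(n \<bullet> (y - p)) *\<^sub>R (x - p) - (n \<bullet> (x - p)) *\<^sub>R (y - p) = orient p x y *\<^sub>R (- quarter_turn n)"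
        by (simp add: orient_def cross_def inner_vec_def sum_2 vec_eq_iff forall_2 quarter_turn_def algebra_simps)
      then have "(n \<bullet> (y - p)) *\<^sub>R (x - p) = (n \<bullet> (x - p)) *\<^sub>R (y - p)" using that by simp
      then have "(1 / (n \<bullet> (y - p))) *\<^sub>R ((n \<bullet> (y - p)) *\<^sub>R (x - p)) = k *\<^sub>R (y - p)"
        by (simp add: k_def)
      then have "x - p = k *\<^sub>R (y - p)" using pos[OF that(2)] by simp
      then have "x = (1 - k) *\<^sub>R p + k *\<^sub>R y" by (simp add: algebra_simps)
      moreover have "(1 - k) *\<^sub>R p + k *\<^sub>R y \<in> convex hull (S - {x})"
        using k that p by (intro convexD[OF convex_convex_hull]) (auto simp: hull_inc)
      ultimately show False using ext[of x] that by auto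
    qed
    fix x y assume xy: "x \<in> ?S" "y \<in> ?S" "slope x = slope y" "x \<noteq> y"
    then have z: "orient p x y = 0" using orient_slope[of x y] n0 by auto
    then have "orient p y x = 0" using orient_rotate[of p y x] orient_swap[of x p y] orient_rotate[of x p y]
      by (simp add: orient_def cross_def algebra_simps)
    then show False using *[of x y] *[of y x] xy z by (metis linear)
  qed
  define ks where "ks = sorted_list_of_set (slope ` ?S)"
  define g where "g = the_inv_into ?S slope"
  define xs where "xs = map g ks"
  have ks: "set ks = slope ` ?S" "sorted_wrt (<) ks"
    using assms(1) by (simp_all add: ks_def)
  have g: "g k \<in> ?S" "slope (g k) = k" if "k \<in> set ks" for k
    using that inj ks(1) by (auto simp: g_def the_inv_into_f_f f_the_inv_into_f)
  have set_xs: "set xs = ?S"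
    using ks(1) inj by (force simp: xs_def g_def the_inv_into_f_f)
  have xs: "xs ! i \<in> ?S" if "i < length xs" for i using that set_xs nth_mem by blast
  have slopes: "slope (xs ! i) < slope (xs ! j)" if "i < j" "j < length xs" for i j
    using that ks(2) g(2) by (simp add: xs_def sorted_wrt_iff_nth_less)
  have inner: "0 < orient (xs ! i) (xs ! j) (xs ! k)" if ijk: "i < j" "j < k" "k < length xs" for i j k
  proof (rule ccontr)
    assume neg: "\<not> 0 < orient (xs ! i) (xs ! j) (xs ! k)"
    define x y z where "x = xs ! i" and "y = xs ! j" and "z = xs ! k"
    have S: "x \<in> ?S" "y \<in> ?S" "z \<in> ?S" using xs ijk by (auto simp: x_def y_def z_def)
    have pos3: "0 < orient p x y" "0 < orient p y z" "0 < orient p x z"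
      using orient_pos S slopes ijk by (simp_all add: x_def y_def z_def)
    have ne: "x \<noteq> y" "z \<noteq> y" using pos3 by (auto simp: orient_same)
    define \<alpha> where "\<alpha> = orient p y z / orient p x z"
    define \<gamma> where "\<gamma> = orient p x y / orient p x z"
    have "y - p = \<alpha> *\<^sub>R (x - p) + \<gamma> *\<^sub>R (z - p)"
      unfolding \<alpha>_def \<gamma>_def orient_def using pos3(3) by (intro cross_coordinates) (simp add: orient_def)
    then have y: "y = (1 - \<alpha> - \<gamma>) *\<^sub>R p + \<alpha> *\<^sub>R x + \<gamma> *\<^sub>R z" by (simp add: algebra_simps)
    have "orient x y z = orient p x y + orient p y z - orient p x z"
      by (simp add: orient_def cross_def algebra_simps)
    then have "orient p y z + orient p x y \<le> orient p x z" using neg by (simp add: x_def y_def z_def)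
    then have "\<alpha> + \<gamma> \<le> 1" using pos3 by (simp add: \<alpha>_def \<gamma>_def add_divide_distrib[symmetric])
    then have "y \<in> convex hull {p, x, z}"
      unfolding convex_hull_3 using pos3
      by (subst y) (force simp: \<alpha>_def \<gamma>_def)
    moreover have "convex hull {p, x, z} \<subseteq> convex hull (S - {y})" using S p ne by (intro hull_mono) auto
    ultimately show False using ext[of y] S by auto
  qed
  have "ccw_polygon (p # xs)"
    unfolding ccw_polygon_def
  proof (intro allI impI)
    fix i j k assume ijk: "k < length (p # xs)" "j < k" "i < j"
    then obtain j' k' where jk: "j = Suc j'" "k = Suc k'" by (metis less_nat_zero_code not0_implies_Suc)
    show "0 < orient ((p # xs) ! i) ((p # xs) ! j) ((p # xs) ! k)"
    proof (cases i)
      case 0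
      then show ?thesis using ijk jk orient_pos[OF xs[of j'] xs[of k'] slopes[of j' k']] by simp
    next
      case (Suc i')
      then show ?thesis using ijk jk inner[of i' j' k'] by simp
    qed
  qed
  moreover have "set (p # xs) = S" using set_xs p by auto
  ultimately show ?thesis by blast
qed

section \<open>Removing one edge of a hexagon\<close>

lemma cross_edges:
  "(B - A) \<otimes> (C - B) = orient A B C"
  "(B - A) \<otimes> ((X - B) + (C - X)) = orient A B C"
  "((X - A) + (B - X)) \<otimes> (C - B) = orient A B C"
  by (simp_all add: orient_def cross_def algebra_simps)

lemma ccw_polygon_five:
  "ccw_polygon [A, B, C, D, E] \<longleftrightarrow>
     0 < orient A B C \<and> 0 < orient A B D \<and> 0 < orient A C D \<and> 0 < orient B C D \<and>
     0 < orient A B E \<and> 0 < orient A C E \<and> 0 < orient A D E \<and>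
     0 < orient B C E \<and> 0 < orient B D E \<and> 0 < orient C D E"
  by (auto simp: ccw_polygon_def All_less_Suc)

lemma ccw_polygon_six:
  "ccw_polygon [A, B, C, D, E, F] \<longleftrightarrow> ccw_polygon [A, B, C, D, E] \<and>
     0 < orient A B F \<and> 0 < orient A C F \<and> 0 < orient A D F \<and> 0 < orient A E F \<and>
     0 < orient B C F \<and> 0 < orient B D F \<and> 0 < orient B E F \<and>
     0 < orient C D F \<and> 0 < orient C E F \<and> 0 < orient D E F"
  unfolding ccw_polygon_five by (auto simp: ccw_polygon_def All_less_Suc)

lemma area_ccw_pentagon:
  assumes "ccw_polygon [A, B, C, D, E]"
  shows "area (convex hull (set [A, B, C, D, E])) = (orient A B C + orient A C D + orient A D E) / 2"
proof -
  have "ccw_polygon [A, B, C, D]" using ccw_polygon_butlast[of "[A, B, C, D]" E] assms by simp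
  moreover have "area (convex hull (set [A, B, C])) = orient A B C / 2"
    using assms by (simp add: area_triangle ccw_polygon_five)
  ultimately show ?thesis
    using area_ccw_polygon_snoc[of "[A, B, C]" D] area_ccw_polygon_snoc[of "[A, B, C, D]" E] assms
    by (simp add: field_simps)
qed

lemma area_ccw_hexagon:
  assumes "ccw_polygon [A, B, C, D, E, F]"
  shows "area (convex hull (set [A, B, C, D, E, F])) =
    (orient A B C + orient A C D + orient A D E + orient A E F) / 2"
proof -
  have "ccw_polygon [A, B, C, D, E]" using assms by (simp add: ccw_polygon_six)
  then show ?thesis
    using area_ccw_pentagon area_ccw_polygon_snoc[of "[A, B, C, D, E]" F] assms
    by (simp add: field_simps)
qed

lemma ccw_hexagon_edges:
  assumes "ccw_polygon [A, B, C, D, E, F]"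
  shows "hexagon_edges (B - A) (C - B) (D - C) (E - D) (F - E) (A - F)"
proof -
  have "orient F A B = orient A B F" "orient E F B = orient B E F" "orient F A C = orient A C F"
    "orient E A B = orient A B E" "orient F B C = orient B C F" "orient E F A = orient A E F"
    "orient D E A = orient A D E" "orient D F A = orient A D F"
    by (simp_all add: orient_def cross_def algebra_simps)
  then show ?thesis
    using assms unfolding hexagon_edges_def cross_edges ccw_polygon_six ccw_polygon_five by simp
qed

lemma area_eq_hexagon_area2:
  assumes "ccw_polygon [A, B, C, D, E, F]"
  shows "hexagon_area2 (B - A) (C - B) (D - C) (E - D) (F - E) (A - F) =
    2 * area (convex hull (set [A, B, C, D, E, F]))"
  unfolding area_ccw_hexagon[OF assms]
  by (simp add: hexagon_area2_def orient_def cross_def algebra_simps)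

text \<open>
  The point \<open>G = E + s d = F - t f\<close> is the apex of the cap of \<open>EF\<close>. Most orientations of the pentagon follow because
  \<open>G\<close> lies on the line \<open>DE\<close> beyond \<open>E\<close> and on the line \<open>AF\<close> beyond \<open>F\<close>. The exception is the position of \<open>G\<close> relative to \<open>BC\<close>:
  with \<open>h\<close> the height over \<open>BC\<close>, the apex could only be below \<open>BC\<close> if \<open>E\<close> is lower than \<open>D\<close> and \<open>F\<close> is lower than \<open>A\<close>,
  but the triangle \<open>C, D, A\<close> shows that \<open>E\<close> and \<open>F\<close> are both higher than the lower one of \<open>D\<close> and \<open>A\<close>.
\<close>
lemma remove_edge:
  fixes A B C D E F :: "real^2"
  defines "d \<equiv> E - D" and "e \<equiv> F - E" and "f \<equiv> A - F"
  defines "P \<equiv> convex hull (set [A, B, C, D, E, F])"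
  assumes ccw: "ccw_polygon [A, B, C, D, E, F]" and df: "0 < d \<otimes> f"
    and small: "3 * ((d \<otimes> e) * (e \<otimes> f)) \<le> area P * (d \<otimes> f)"
  shows "\<exists>G. ccw_polygon [A, B, C, D, G] \<and> P \<subseteq> convex hull (set [A, B, C, D, G]) \<and>
    area (convex hull (set [A, B, C, D, G])) \<le> 7 / 6 * area P"
proof -
  note o = ccw[unfolded ccw_polygon_six ccw_polygon_five]
  define s where "s = (e \<otimes> f) / (d \<otimes> f)"
  define t where "t = (d \<otimes> e) / (d \<otimes> f)"
  have de: "0 < d \<otimes> e" and ef: "0 < e \<otimes> f"
    using ccw_hexagon_edges[OF ccw] by (simp_all add: hexagon_edges_def d_def e_def f_def)
  have st: "0 < s" "0 < t" using de ef df by (simp_all add: s_def t_def)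
  define G where "G = (1 + s) *\<^sub>R E + (- s) *\<^sub>R D"
  have "e = s *\<^sub>R d + t *\<^sub>R f" unfolding s_def t_def using df by (intro cross_coordinates) simp
  then have G': "G = (1 + t) *\<^sub>R F + (- t) *\<^sub>R A"
    by (simp add: G_def d_def e_def f_def algebra_simps)
  have GD: "orient X Y G = (1 + s) * orient X Y E + (- s) * orient X Y D" for X Y
    unfolding G_def by (rule orient_affine_combination) simp
  have GA: "orient X Y G = (1 + t) * orient X Y F + (- t) * orient X Y A" for X Y
    unfolding G' by (rule orient_affine_combination) simp
  have BCG: "0 < orient B C G"
  proof (rule ccontr)
    assume neg: "\<not> 0 < orient B C G"
    define h where "h = orient B C"
    have pos: "0 < h D" "0 < h E" "0 < h F" "0 < h A" using o by (simp_all add: h_def orient_rotate[of B C A])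
    have "h G = h E + s * (h E - h D)"
      unfolding h_def GD by (simp add: algebra_simps)
    moreover have "h G = h F + t * (h F - h A)"
      unfolding h_def GA by (simp add: algebra_simps)
    moreover have "h G \<le> 0" using neg by (simp add: h_def)
    ultimately have "s * (h E - h D) < 0" "t * (h F - h A) < 0" using pos by linarith+
    then have low: "h E < h D" "h F < h A" using st by (simp_all add: mult_less_0_iff)
    \<comment> \<open>\<open>M\<close> has barycentric coordinates of signs \<open>-, +, +\<close> with respect to \<open>C\<close>, \<open>D\<close>, \<open>A\<close>, and \<open>h\<close> vanishes at \<open>C\<close>.\<close>
    have between: "min (h D) (h A) < h M"
      if M: "0 < orient C D M" "0 < orient D M A" "0 < orient C M A" for M
    proof -
      have CDA: "orient C D A = orient C D M + orient C M A - orient D M A" 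
        by (simp add: orient_def cross_def algebra_simps)
      have "orient C D A * h M = orient C M A * h D + orient C D M * h A"
        by (simp add: h_def orient_def cross_def algebra_simps)
      also have "\<dots> \<ge> orient C M A * min (h D) (h A) + orient C D M * min (h D) (h A)"
        using M by (intro add_mono mult_left_mono) auto
      also have "orient C M A * min (h D) (h A) + orient C D M * min (h D) (h A) =
          orient C D A * min (h D) (h A) + orient D M A * min (h D) (h A)"
        unfolding CDA by (simp add: algebra_simps)
      finally have "orient C D A * min (h D) (h A) < orient C D A * h M"
        using M pos by (smt (verit) mult_pos_pos min_def)
      moreover have "0 < orient C D A" using o by (simp add: orient_rotate[of C D A])
      ultimately show ?thesis by (simp add: mult_less_cancel_left)
    qed
    have "min (h D) (h A) < h E" "min (h D) (h A) < h F"
      using o by (auto intro!: between simp: orient_rotate[of _ _ A])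
    then show False using low by linarith
  qed
  have Q: "ccw_polygon [A, B, C, D, G]"
    unfolding ccw_polygon_five using o st BCG
    by (simp add: GA[of A] GD[of _ D] orient_same)
  let ?Q = "convex hull (set [A, B, C, D, G])"
  have "E \<in> ?Q"
  proof -
    have "(1 / (1 + s)) *\<^sub>R G + (s / (1 + s)) *\<^sub>R D = (1 / (1 + s)) *\<^sub>R (G + s *\<^sub>R D)"
      by (simp add: scaleR_add_right)
    also have "G + s *\<^sub>R D = (1 + s) *\<^sub>R E" by (simp add: G_def)
    finally have "E = (1 / (1 + s)) *\<^sub>R G + (s / (1 + s)) *\<^sub>R D" using st by simp
    moreover have "(1 / (1 + s)) *\<^sub>R G + (s / (1 + s)) *\<^sub>R D \<in> ?Q"
      using st by (intro convexD[OF convex_convex_hull]) (auto simp: hull_inc add_divide_distrib[symmetric])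
    ultimately show ?thesis by simp
  qed
  moreover have "F \<in> ?Q"
  proof -
    have "(1 / (1 + t)) *\<^sub>R G + (t / (1 + t)) *\<^sub>R A = (1 / (1 + t)) *\<^sub>R (G + t *\<^sub>R A)"
      by (simp add: scaleR_add_right)
    also have "G + t *\<^sub>R A = (1 + t) *\<^sub>R F" by (simp add: G')
    finally have "F = (1 / (1 + t)) *\<^sub>R G + (t / (1 + t)) *\<^sub>R A" using st by simp
    moreover have "(1 / (1 + t)) *\<^sub>R G + (t / (1 + t)) *\<^sub>R A \<in> ?Q"
      using st by (intro convexD[OF convex_convex_hull]) (auto simp: hull_inc add_divide_distrib[symmetric])
    ultimately show ?thesis by simp
  qed
  ultimately have sub: "P \<subseteq> ?Q" unfolding P_def
    by (intro hull_minimal convex_convex_hull) (auto simp: hull_inc)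
  have "orient A D G = orient A D E + orient A E F + s * (d \<otimes> e)"
  proof -
    have "orient A D G = orient A D E + s * (d \<otimes> e + d \<otimes> f)"
      unfolding GD by (simp add: orient_def d_def e_def f_def cross_def algebra_simps)
    moreover have "s * (d \<otimes> f) = orient A E F"
      using df by (simp add: s_def) (simp add: e_def f_def orient_def cross_def algebra_simps)
    ultimately show ?thesis by (simp add: algebra_simps)
  qed
  then have "area ?Q = area P + (d \<otimes> e) * (e \<otimes> f) / (d \<otimes> f) / 2"
    unfolding P_def area_ccw_hexagon[OF ccw] area_ccw_pentagon[OF Q] by (simp add: s_def field_simps)
  moreover have "3 * ((d \<otimes> e) * (e \<otimes> f) / (d \<otimes> f)) \<le> area P" using small df by (simp add: divide_le_eq)
  ultimately have "area ?Q \<le> 7 / 6 * area P" by simp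
  then show ?thesis using Q sub by blast
qed

lemma convex_polygon_ccw_pentagon:
  assumes "ccw_polygon [A, B, C, D, E]"
  shows "convex_polygon (convex hull (set [A, B, C, D, E]))"
proof -
  have "0 < area (convex hull (set [A, B, C, D, E]))"
    unfolding area_ccw_pentagon[OF assms] using assms by (simp add: ccw_polygon_five)
  then have "\<not> negligible (convex hull (set [A, B, C, D, E]))"
    using negligible_imp_measure0 by force
  then have "interior (convex hull (set [A, B, C, D, E])) \<noteq> {}"
    using negligible_convex_interior[OF convex_convex_hull] by blast
  then show ?thesis unfolding convex_polygon_def by (simp add: polytope_convex_hull)
qed

theorem theorem4p1:
  fixes P :: "(real^2) set"
  assumes "convex_polygon P"
    and "card (vertices P) = 6"
  shows "\<exists>A B C D E F. cyclic_vertices P [A, B, C, D, E, F] \<and>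
           (\<exists>G H Q. convex_polygon Q \<and> cyclic_vertices Q [B, C, D, G, H] \<and>
                    P \<subseteq> Q \<and> area Q \<le> 7 / 6 * area P)"
proof -
  let ?V = "vertices P"
  have "polytope P" using assms(1) by (simp add: convex_polygon_def)
  then have P: "P = convex hull ?V"
    unfolding vertices_def by (intro Krein_Milman_Minkowski polytope_imp_compact polytope_imp_convex)
  have "s \<notin> convex hull (?V - {s})" if "s \<in> ?V" for s
  proof -
    have "convex (P - {s})" using that \<open>polytope P\<close>
      by (simp add: vertices_def extreme_point_of_stillconvex polytope_imp_convex)
    moreover have "?V - {s} \<subseteq> P - {s}" by (auto simp: vertices_def extreme_point_of_def)
    ultimately have "convex hull (?V - {s}) \<subseteq> P - {s}" by (rule hull_minimal[rotated])
    then show ?thesis by blast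
  qed
  moreover have "finite ?V" "?V \<noteq> {}" using assms(2) by (auto intro: card_ge_0_finite)
  ultimately obtain vs where vs: "set vs = ?V" "ccw_polygon vs"
    using convex_position_ccw_polygon by blast
  have "length vs = 6"
  proof -
    have "6 \<le> length vs" using card_length[of vs] vs(1) assms(2) by simp
    then have "distinct vs" using vs(2) by (intro ccw_polygon_distinct) auto
    then show ?thesis using distinct_card[of vs] vs(1) assms(2) by simp
  qed
  then obtain A B C D E F where vs_eq: "vs = [A, B, C, D, E, F]"
    by (auto simp: numeral_eq_Suc length_Suc_conv)
  note ccw = vs(2)[unfolded vs_eq]
  \<comment> \<open>It suffices to find a small cap, at any position of the vertex list.\<close>
  have found: ?thesis
    if "\<exists>n. rotate n [A, B, C, D, E, F] = [A', B', C', D', E', F']"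
      and ear: "0 < (E' - D') \<otimes> (A' - F')"
      "6 * (((E' - D') \<otimes> (F' - E')) * ((F' - E') \<otimes> (A' - F'))) \<le> 2 * area P * ((E' - D') \<otimes> (A' - F'))"
    for A' B' C' D' E' F'
  proof -
    from that(1) obtain n where n: "rotate n [A, B, C, D, E, F] = [A', B', C', D', E', F']" ..
    have ccw': "ccw_polygon [A', B', C', D', E', F']" using ccw_polygon_rotate[OF ccw, of n] n by simp
    have set': "set [A', B', C', D', E', F'] = ?V" by (metis n set_rotate vs(1) vs_eq)
    have P': "P = convex hull (set [A', B', C', D', E', F'])" unfolding set' by (rule P)
    from remove_edge[OF ccw' ear(1)] obtain G where
      G: "ccw_polygon [A', B', C', D', G]" "P \<subseteq> convex hull (set [A', B', C', D', G])"
        "area (convex hull (set [A', B', C', D', G])) \<le> 7 / 6 * area P"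
      unfolding P'[symmetric] using ear(2) by auto
    have "cyclic_vertices P [A', B', C', D', E', F']"
      using ccw_polygon_cyclic_vertices[OF ccw'] unfolding P'[symmetric] by simp
    moreover have "cyclic_vertices (convex hull (set [A', B', C', D', G])) [B', C', D', G, A']"
    proof -
      have "set [B', C', D', G, A'] = set [A', B', C', D', G]" by auto
      moreover have "ccw_polygon [B', C', D', G, A']" using ccw_polygon_rotate1[OF G(1)] by simp
      ultimately show ?thesis using ccw_polygon_cyclic_vertices[of "[B', C', D', G, A']"] by simp
    qed
    ultimately show ?thesis using convex_polygon_ccw_pentagon[OF G(1)] G(2,3) by blast
  qed
  have rot: "rotate 0 [A, B, C, D, E, F] = [A, B, C, D, E, F]"
    "rotate 1 [A, B, C, D, E, F] = [B, C, D, E, F, A]"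
    "rotate 2 [A, B, C, D, E, F] = [C, D, E, F, A, B]"
    "rotate 3 [A, B, C, D, E, F] = [D, E, F, A, B, C]"
    "rotate 4 [A, B, C, D, E, F] = [E, F, A, B, C, D]"
    "rotate 5 [A, B, C, D, E, F] = [F, A, B, C, D, E]"
    by (simp_all add: numeral_eq_Suc)
  have "2 * area P = hexagon_area2 (B - A) (C - B) (D - C) (E - D) (F - E) (A - F)"
    using area_eq_hexagon_area2[OF ccw] P vs(1) vs_eq by metis
  with ex_small_cap[OF ccw_hexagon_edges[OF ccw]]
  consider
      "0 < (A - F) \<otimes> (C - B)" "6 * (((A - F) \<otimes> (B - A)) * ((B - A) \<otimes> (C - B))) \<le> 2 * area P * ((A - F) \<otimes> (C - B))"
    | "0 < (B - A) \<otimes> (D - C)" "6 * (((B - A) \<otimes> (C - B)) * ((C - B) \<otimes> (D - C))) \<le> 2 * area P * ((B - A) \<otimes> (D - C))"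
    | "0 < (C - B) \<otimes> (E - D)" "6 * (((C - B) \<otimes> (D - C)) * ((D - C) \<otimes> (E - D))) \<le> 2 * area P * ((C - B) \<otimes> (E - D))"
    | "0 < (D - C) \<otimes> (F - E)" "6 * (((D - C) \<otimes> (E - D)) * ((E - D) \<otimes> (F - E))) \<le> 2 * area P * ((D - C) \<otimes> (F - E))"
    | "0 < (E - D) \<otimes> (A - F)" "6 * (((E - D) \<otimes> (F - E)) * ((F - E) \<otimes> (A - F))) \<le> 2 * area P * ((E - D) \<otimes> (A - F))"
    | "0 < (F - E) \<otimes> (B - A)" "6 * (((F - E) \<otimes> (A - F)) * ((A - F) \<otimes> (B - A))) \<le> 2 * area P * ((F - E) \<otimes> (B - A))"
    by auto
  then show ?thesis
  proof cases
    case 1 then show ?thesis using rot by (intro found[of C D E F A B]) blast+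
  next
    case 2 then show ?thesis using rot by (intro found[of D E F A B C]) blast+
  next
    case 3 then show ?thesis using rot by (intro found[of E F A B C D]) blast+
  next
    case 4 then show ?thesis using rot by (intro found[of F A B C D E]) blast+
  next
    case 5 then show ?thesis using rot by (intro found[of A B C D E F]) blast+
  next
    case 6 then show ?thesis using rot by (intro found[of B C D E F A]) blast+
  qed
qed

end
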